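(* Let $E$ be a Banach space with topological dual $E'$, let $E_w$ denote $E$ endowed with the weak topology $\sigma(E,E')$, and let $B_w$ denote the closed unit ball of $E$ with the topology induced from $E_w$. The following conditions are equivalent: (i) $B_w$ is Polish; (ii) $B_w$ is a Čech-complete $\aleph$-space; (iii) $B_w$ has countable $cs^\ast$-character and is Čech-complete; (iv) $E_w$ has countable $cs^\ast$-character and $B_w$ is a Čech-complete space.
   Context: A family $\mathcal{N}$ of subsets of a topological space $X$ is a $k$-network if for any open $U\subset X$ and compact $K\subset U$ there is a finite subfamily $\mathcal{F}\subset\mathcal{N}$ such that $K\subset\bigcup\mathcal{F}\subset U$. $X$ is an $\aleph$-space if it is regular (including $T_1$) and has a $\sigma$-locally finite $k$-network (i.e. a $k$-network that is a countable union of locally finite families). $X$ has countable $cs^\ast$-character if for each $x\in X$ there is a countable family $\mathcal{D}$ of subsets of $X$ such that for each sequence in $X$ converging to $x$ and each neighborhood $U$ of $x$ there is $D\in\mathcal{D}$ such that $D\subset U$ and $D$ contains infinitely many elements of that sequence (i.e. the $n$-th term lies in $D$ for infinitely many indices $n$). *)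

theory Defs
  imports "HOL-Analysis.Analysis"
begin

definition k_network :: "'a topology \<Rightarrow> 'a set set \<Rightarrow> bool" where
  "k_network X \<N> \<longleftrightarrow>
     \<N> \<subseteq> Pow (topspace X) \<and>
     (\<forall>U K. openin X U \<and> compactin X K \<and> K \<subseteq> U \<longrightarrow>
        (\<exists>\<F>. finite \<F> \<and> \<F> \<subseteq> \<N> \<and> K \<subseteq> \<Union>\<F> \<and> \<Union>\<F> \<subseteq> U))"

definition sigma_locally_finite_in :: "'a topology \<Rightarrow> 'a set set \<Rightarrow> bool" where
  "sigma_locally_finite_in X \<N> \<longleftrightarrow>
     (\<exists>\<A> :: nat \<Rightarrow> 'a set set. (\<forall>n. locally_finite_in X (\<A> n)) \<and> \<N> = (\<Union>n. \<A> n))"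

text \<open>The library's \<^const>\<open>regular_space\<close> does not include any \<open>T\<^sub>1\<close> requirement.\<close>

definition aleph_space :: "'a topology \<Rightarrow> bool" where
  "aleph_space X \<longleftrightarrow>
     regular_space X \<and> t1_space X \<and> (\<exists>\<N>. k_network X \<N> \<and> sigma_locally_finite_in X \<N>)"

text \<open>Neighborhoods need not be open. ``Infinitely many elements of the sequence'' is counted by
  indices, so constant sequences are included.\<close>

definition countable_cs_star_character :: "'a topology \<Rightarrow> bool" where
  "countable_cs_star_character X \<longleftrightarrow>
     (\<forall>x \<in> topspace X. \<exists>\<D>. countable \<D> \<and> \<D> \<subseteq> Pow (topspace X) \<and>
        (\<forall>s :: nat \<Rightarrow> 'a. \<forall>U.
           range s \<subseteq> topspace X \<and> limitin X s x sequentially \<and>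
           U \<subseteq> topspace X \<and> (\<exists>V. openin X V \<and> x \<in> V \<and> V \<subseteq> U) \<longrightarrow>
           (\<exists>D \<in> \<D>. D \<subseteq> U \<and> infinite {n. s n \<in> D})))"

definition polish_space_top :: "'a topology \<Rightarrow> bool" where
  "polish_space_top X \<longleftrightarrow> separable_space X \<and> completely_metrizable_space X"

text \<open>The Stone--Cech compactification of a Tychonoff space \<open>X\<close>, as the closure of the image of \<open>X\<close>
  under evaluation in the cube indexed by all continuous maps \<open>X \<rightarrow> [0,1]\<close>. The index maps are
  normalized to be \<^const>\<open>undefined\<close> off the carrier, so each continuous map occurs exactly once.\<close>

definition unit_maps :: "'a topology \<Rightarrow> ('a \<Rightarrow> real) set" where
  "unit_maps X = {f \<in> extensional (topspace X). continuous_map X (top_of_set {0..1}) f}"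

definition unit_cube :: "'a topology \<Rightarrow> (('a \<Rightarrow> real) \<Rightarrow> real) topology" where
  "unit_cube X = product_topology (\<lambda>f. top_of_set {0..1}) (unit_maps X)"

definition stone_cech_map :: "'a topology \<Rightarrow> 'a \<Rightarrow> ('a \<Rightarrow> real) \<Rightarrow> real" where
  "stone_cech_map X x = (\<lambda>f \<in> unit_maps X. f x)"

definition stone_cech :: "'a topology \<Rightarrow> (('a \<Rightarrow> real) \<Rightarrow> real) topology" where
  "stone_cech X =
     subtopology (unit_cube X) (unit_cube X closure_of (stone_cech_map X ` topspace X))"

definition cech_complete_space :: "'a topology \<Rightarrow> bool" where
  "cech_complete_space X \<longleftrightarrow>
     completely_regular_space X \<and> Hausdorff_space X \<and>
     gdelta_in (stone_cech X) (stone_cech_map X ` topspace X)"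

definition weak_topology :: "'a::real_normed_vector topology" where
  "weak_topology =
     topology_generated_by {blinfun_apply f -` U | (f :: 'a \<Rightarrow>\<^sub>L real) U. open U}"

definition weak_unit_ball :: "'a::real_normed_vector topology" where
  "weak_unit_ball = subtopology weak_topology (cball 0 1)"

lemma topspace_weak_topology [simp]:
  "topspace (weak_topology :: 'a::real_normed_vector topology) = UNIV"
proof -
  have "blinfun_apply (0 :: 'a \<Rightarrow>\<^sub>L real) -` UNIV \<in> {blinfun_apply f -` U | (f :: 'a \<Rightarrow>\<^sub>L real) U. open U}"
    using open_UNIV by blast
  then show ?thesis
    unfolding weak_topology_def topology_generated_by_topspace vimage_UNIV by blast
qed

lemma topspace_weak_unit_ball [simp]: "topspace weak_unit_ball = cball 0 1"
  by (simp add: weak_unit_ball_def)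

lemma unit_maps_eq_cfunspace:
  "unit_maps X = mspace (submetric (cfunspace X euclidean_metric) {f. f \<in> topspace X \<rightarrow> {0..1}})"
proof -
  have bdd: "bounded (f ` topspace X)" if "f \<in> topspace X \<rightarrow> {0..1}" for f :: "'a \<Rightarrow> real"
    using that by (intro bounded_subset [OF bounded_closed_interval]) (auto simp: Pi_iff)
  show ?thesis
    unfolding unit_maps_def continuous_map_in_subtopology image_subset_iff_funcset
    by (simp, blast dest: bdd)
qed

lemma embedding_map_stone_cech:
  assumes "completely_regular_space X" "Hausdorff_space X"
  shows "embedding_map X (stone_cech X) (stone_cech_map X)"
proof -
  have emb: "embedding_map X (unit_cube X) (stone_cech_map X)"
    using completely_regular_space_cube_embedding_explicit [OF assms]
    unfolding unit_cube_def stone_cech_map_def [abs_def] unit_maps_eq_cfunspace .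
  then have "continuous_map X (unit_cube X) (stone_cech_map X)"
    unfolding embedding_map_def
    by (rule homeomorphic_imp_continuous_map [THEN continuous_map_into_fulltopology])
  then have "stone_cech_map X ` topspace X \<subseteq> topspace (unit_cube X)"
    by (rule continuous_map_image_subset_topspace)
  then have "stone_cech_map X ` topspace X
      \<subseteq> unit_cube X closure_of (stone_cech_map X ` topspace X)"
    by (simp add: closure_of_subset)
  with emb show ?thesis
    by (simp add: stone_cech_def embedding_map_in_subtopology)
qed

end

theory Submission
  imports Defs
begin

text \<open>
Write \<open>B\<close> for the closed unit ball with the weak topology. A Polish space is \<open>G\<^sub>\<delta>\<close> in its Stone-Cech
compactification, by Lavrentiev's theorem, and its countable base is a \<open>k\<close>-network; this gives (ii)
from (i). In an \<open>\<aleph>\<close>-space the members of the \<open>k\<close>-network whose closure contains a given point are a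
countable \<open>cs\<^sup>*\<close>-network there, which gives (iii). Conditions (iii) and (iv) are exchanged by passing
to the subspace \<open>B\<close> and, conversely, by the boundedness of weakly convergent sequences, which lets
translated multiples of a network at \<open>0\<close> in \<open>B\<close> serve at any point of the space.

The substance is the step from (iii) to (i). Cech-completeness is used in the form of a sequence of
open covers that forces cluster points (\<open>cech_complete_space_covers\<close>). It makes an argument of
Whitley work for \<open>B\<close>: if \<open>0\<close> is in the weak closure of each \<open>A n \<subseteq> B\<close>, then some \<open>x n \<in> A n\<close> converge
weakly to \<open>0\<close> (\<open>weak_ball_sequence_selection\<close>). If the finite unions of the network elements inside
a neighbourhood \<open>U\<close> of \<open>0\<close> all failed to be neighbourhoods of \<open>0\<close>, such a sequence could be chosen to
avoid them one after another, contradicting the network property. So \<open>0\<close> has a countable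
neighbourhood base in \<open>B\<close> (\<open>weak_ball_countable_base_at_zero\<close>). This base involves only countably
many functionals, and halving differences carries it from \<open>0\<close> to every point of \<open>B\<close>; evaluating
these functionals embeds \<open>B\<close> into the Polish space of real sequences
(\<open>weak_ball_embeds_in_sequences\<close>). There the image is \<open>G\<^sub>\<delta>\<close>, again by the covers
(\<open>cech_complete_subset_imp_gdelta\<close>).

The functional-analytic input is the Hahn-Banach theorem: norming functionals, and the separation
of points from closed subspaces.
\<close>

section \<open>The Hahn-Banach theorem\<close>

text \<open>Only \<open>\<le>\<close> is required for scaling; applied to the inverse factor it gives equality. This makes
sublinearity of an infimum of functions easier to check.\<close>

definition sublinear :: "('a::real_vector \<Rightarrow> real) \<Rightarrow> bool" where
  "sublinear p \<longleftrightarrow> (\<forall>x y. p (x + y) \<le> p x + p y) \<and> (\<forall>c x. 0 \<le> c \<longrightarrow> p (c *\<^sub>R x) \<le> c * p x)"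

lemma sublinearD:
  assumes "sublinear p"
  shows sublinear_add: "p (x + y) \<le> p x + p y"
    and sublinear_zero: "p 0 = 0"
    and sublinear_scale: "0 \<le> c \<Longrightarrow> p (c *\<^sub>R x) = c * p x"
    and sublinear_lower: "- p (- x) \<le> p x"
proof -
  show add: "p (x + y) \<le> p x + p y" for x y using assms unfolding sublinear_def by blast
  have le: "p (c *\<^sub>R x) \<le> c * p x" if "0 \<le> c" for c x using assms that unfolding sublinear_def by blast
  show zero: "p 0 = 0" using add[of 0 0] le[of 0 0] by simp
  show "p (c *\<^sub>R x) = c * p x" if "0 \<le> c"
  proof (cases "c = 0")
    case False
    then have c: "0 < c" using that by simp
    have "p x \<le> inverse c * p (c *\<^sub>R x)"
      using le[of "inverse c" "c *\<^sub>R x"] c by simp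
    then have "c * p x \<le> p (c *\<^sub>R x)" using c by (simp add: field_simps)
    then show ?thesis using le[OF that, of x] by simp
  qed (simp add: zero)
  show "- p (- x) \<le> p x" using add[of x "- x"] zero by simp
qed

text \<open>The largest sublinear functional below \<open>p\<close> whose value at \<open>- y\<close> is \<open>- p y\<close>. A sublinear functional
is linear exactly if lowering it along every ray leaves it unchanged.\<close>

definition ray_lowering :: "('a::real_vector \<Rightarrow> real) \<Rightarrow> 'a \<Rightarrow> 'a \<Rightarrow> real" where
  "ray_lowering p y x = (INF t\<in>{0..}. p (x + t *\<^sub>R y) - t * p y)"

text \<open>The infimum is finite because \<open>p (x + t y) - t p y \<ge> - p (- x)\<close>, and subadditivity survives since the
parameters \<open>t\<close> and \<open>s\<close> belonging to two points can be added.\<close>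

lemma
  assumes p: "sublinear p"
  shows ray_lowering_le: "0 \<le> t \<Longrightarrow> ray_lowering p y x \<le> p (x + t *\<^sub>R y) - t * p y"
    and ray_lowering_le_self: "ray_lowering p y x \<le> p x"
    and ray_lowering_uminus: "ray_lowering p y (- y) \<le> - p y"
    and sublinear_ray_lowering: "sublinear (ray_lowering p y)"
proof -
  have low: "- p (- x) \<le> p (x + t *\<^sub>R y) - t * p y" if "0 \<le> t" for t x
    using sublinear_add[OF p, of "x + t *\<^sub>R y" "- x"] sublinear_scale[OF p that, of y] by simp
  have bdd: "bdd_below ((\<lambda>t. p (x + t *\<^sub>R y) - t * p y) ` {0..})" for x
    using low by (intro bdd_belowI2[where m = "- p (- x)"]) auto
  show le: "ray_lowering p y x \<le> p (x + t *\<^sub>R y) - t * p y" if "0 \<le> t" for t x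
    unfolding ray_lowering_def using that by (intro cINF_lower bdd) auto
  show "ray_lowering p y x \<le> p x" using le[of 0 x] by simp
  show "ray_lowering p y (- y) \<le> - p y" using le[of 1 "- y"] sublinear_zero[OF p] by simp
  have greatest: "m \<le> ray_lowering p y x" if "\<And>t. 0 \<le> t \<Longrightarrow> m \<le> p (x + t *\<^sub>R y) - t * p y" for m x
    unfolding ray_lowering_def using that by (intro cINF_greatest) auto
  show "sublinear (ray_lowering p y)"
    unfolding sublinear_def
  proof (intro conjI allI impI)
    fix x z
    have *: "ray_lowering p y (x + z) - (p (x + t *\<^sub>R y) - t * p y) \<le> p (z + s *\<^sub>R y) - s * p y"
      if "0 \<le> t" "0 \<le> s" for t s
    proof -
      have "ray_lowering p y (x + z) \<le> p ((x + t *\<^sub>R y) + (z + s *\<^sub>R y)) - (t + s) * p y"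
        using le[of "t + s" "x + z"] that by (simp add: algebra_simps)
      then show ?thesis
        using sublinear_add[OF p, of "x + t *\<^sub>R y" "z + s *\<^sub>R y"] by (simp add: algebra_simps)
    qed
    have "ray_lowering p y (x + z) - (p (x + t *\<^sub>R y) - t * p y) \<le> ray_lowering p y z" if "0 \<le> t" for t
      using that by (intro greatest *)
    then have "ray_lowering p y (x + z) - ray_lowering p y z \<le> ray_lowering p y x"
      by (intro greatest) (smt (verit))
    then show "ray_lowering p y (x + z) \<le> ray_lowering p y x + ray_lowering p y z" by simp
  next
    fix c :: real and x assume "0 \<le> c"
    show "ray_lowering p y (c *\<^sub>R x) \<le> c * ray_lowering p y x"
    proof (cases "c = 0")
      case True
      then show ?thesis using le[of 0 0] sublinear_zero[OF p] by simp
    next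
      case False
      then have c: "0 < c" using \<open>0 \<le> c\<close> by simp
      have "ray_lowering p y (c *\<^sub>R x) / c \<le> p (x + t *\<^sub>R y) - t * p y" if "0 \<le> t" for t
      proof -
        have "ray_lowering p y (c *\<^sub>R x) \<le> p (c *\<^sub>R (x + t *\<^sub>R y)) - (c * t) * p y"
          using le[of "c * t" "c *\<^sub>R x"] that c by (simp add: algebra_simps)
        then show ?thesis
          using sublinear_scale[OF p \<open>0 \<le> c\<close>, of "x + t *\<^sub>R y"] c by (simp add: field_simps)
      qed
      then have "ray_lowering p y (c *\<^sub>R x) / c \<le> ray_lowering p y x" by (rule greatest)
      then show ?thesis using c by (simp add: field_simps)
    qed
  qed
qed

text \<open>Zorn's lemma applies because the pointwise infimum of a chain of sublinear functionals below \<open>p\<close> is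
bounded below by \<open>- p (- x)\<close> and is again sublinear: any two members of the chain are compared
with their smaller one.\<close>

lemma minimal_sublinear_exists:
  assumes p: "sublinear p"
  obtains q where "sublinear q" "q \<le> p" "\<And>r. sublinear r \<Longrightarrow> r \<le> q \<Longrightarrow> r = q"
proof -
  define A where "A = {q. sublinear q \<and> q \<le> p}"
  have "\<exists>m\<in>A. \<forall>a\<in>A. a \<le> m \<longrightarrow> a = m"
  proof (rule predicate_Zorn)
    show "partial_order_on A (relation_of (\<lambda>q r. r \<le> q) A)"
      by (intro partial_order_on_relation_ofI) auto
  next
    fix C assume C: "C \<in> Chains (relation_of (\<lambda>q r. r \<le> q) A)"
    have CA: "q \<in> A" if "q \<in> C" for q
      using C that unfolding Chains_def relation_of_def by auto
    have total: "q \<le> r \<or> r \<le> q" if "q \<in> C" "r \<in> C" for q r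
      using C that unfolding Chains_def relation_of_def by auto
    show "\<exists>u\<in>A. \<forall>a\<in>C. u \<le> a"
    proof (cases "C = {}")
      case True
      then show ?thesis using p by (auto simp: A_def)
    next
      case False
      define u where "u x = (INF q\<in>C. q x)" for x
      have low: "- p (- x) \<le> q x" if "q \<in> C" for q x
        using sublinear_lower[of q x] CA[OF that] by (simp add: A_def le_fun_def) (smt (verit))
      have le: "u x \<le> q x" if "q \<in> C" for q x
        unfolding u_def using that low by (intro cINF_lower bdd_belowI2) auto
      have greatest: "m \<le> u x" if "\<And>q. q \<in> C \<Longrightarrow> m \<le> q x" for m x
        unfolding u_def using False that by (intro cINF_greatest) auto
      have "sublinear u"
        unfolding sublinear_def
      proof (intro conjI allI impI)
        fix x y
        have *: "u (x + y) - q x \<le> r y" if "q \<in> C" "r \<in> C" for q r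
        proof -
          have "\<exists>m\<in>C. m \<le> q \<and> m \<le> r" using total[OF that] that by auto
          then obtain m where m: "m \<in> C" "m \<le> q" "m \<le> r" by blast
          have "u (x + y) \<le> m x + m y"
            using le[OF m(1), of "x + y"] sublinear_add[of m x y] CA[OF m(1)] by (simp add: A_def)
          then show ?thesis using m by (smt (verit) le_fun_def)
        qed
        have "u (x + y) - q x \<le> u y" if "q \<in> C" for q
          using that by (intro greatest *)
        then have "u (x + y) - u y \<le> u x"
          by (intro greatest) (smt (verit))
        then show "u (x + y) \<le> u x + u y" by simp
      next
        fix c :: real and x assume c: "0 \<le> c"
        have *: "u (c *\<^sub>R x) \<le> c * q x" if "q \<in> C" for q
          using le[OF that, of "c *\<^sub>R x"] sublinear_scale[of q c x] CA[OF that] c by (simp add: A_def)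
        show "u (c *\<^sub>R x) \<le> c * u x"
        proof (cases "c = 0")
          case True
          then show ?thesis using * False by auto
        next
          case False
          then have "u (c *\<^sub>R x) / c \<le> u x"
            using * c by (intro greatest) (simp add: field_simps)
          then show ?thesis using False c by (simp add: field_simps)
        qed
      qed
      moreover have "u \<le> p"
        using False le CA by (simp add: A_def le_fun_def) (meson ex_in_conv order_trans)
      ultimately show ?thesis using le by (auto simp: A_def le_fun_def)
    qed
  qed
  then obtain q where "q \<in> A" and "\<forall>a\<in>A. a \<le> q \<longrightarrow> a = q" by blast
  then show ?thesis by (intro that[of q]) (auto simp: A_def)
qed

text \<open>A minimal sublinear functional is unchanged by every ray lowering, so it is odd and hence linear.
Starting below the lowering of \<open>p\<close> along \<open>x0\<close> forces the value \<open>p x0\<close> at \<open>x0\<close>.\<close>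

theorem Hahn_Banach_sublinear:
  assumes p: "sublinear p"
  obtains g where "linear g" "\<And>x. g x \<le> p x" "g x0 = p x0"
proof -
  obtain q where q: "sublinear q" "q \<le> ray_lowering p x0"
    and min: "\<And>r. sublinear r \<Longrightarrow> r \<le> q \<Longrightarrow> r = q"
    using minimal_sublinear_exists[OF sublinear_ray_lowering[OF p]] by blast
  have le: "q x \<le> p x" for x
    using q(2) ray_lowering_le_self[OF p, of x0 x] by (auto simp: le_fun_def intro: order_trans)
  have "ray_lowering q y = q" for y
    using q(1) by (intro min sublinear_ray_lowering) (auto simp: le_fun_def ray_lowering_le_self)
  then have neg: "q (- y) = - q y" for y
    using ray_lowering_uminus[OF q(1), of y] sublinear_lower[OF q(1), of y] by simp
  have add: "q (x + y) = q x + q y" for x y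
    using sublinear_add[OF q(1), of x y] sublinear_add[OF q(1), of "x + y" "- y"] neg[of y] by simp
  have "q (c *\<^sub>R x) = c * q x" for c x
  proof (cases "0 \<le> c")
    case False
    then show ?thesis using sublinear_scale[OF q(1), of "- c" x] neg[of "c *\<^sub>R x"] by simp
  qed (simp add: sublinear_scale[OF q(1)])
  then have "linear q" by (intro linearI) (auto simp: add)
  moreover have "q x0 = p x0"
    using le_funD[OF q(2), of "- x0"] ray_lowering_uminus[OF p, of x0] neg[of x0] le[of x0] by simp
  ultimately show ?thesis using le by (intro that)
qed

lemma sublinear_norm_bounded_dominates:
  fixes p :: "'a::real_normed_vector \<Rightarrow> real"
  assumes p: "sublinear p" and le: "\<And>x. p x \<le> norm x"
  obtains f :: "'a \<Rightarrow>\<^sub>L real" where "norm f \<le> 1" "\<And>x. blinfun_apply f x \<le> p x" "blinfun_apply f x0 = p x0"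
proof -
  obtain g where g: "linear g" "\<And>x. g x \<le> p x" "g x0 = p x0"
    using Hahn_Banach_sublinear[OF p] by blast
  have abs: "\<bar>g x\<bar> \<le> norm x" for x
    using g(2)[of x] g(2)[of "- x"] le[of x] le[of "- x"] linear_neg[OF g(1), of x] by simp
  have bl: "bounded_linear g"
    using g(1) abs by (intro bounded_linear_intro[where K = 1]) (auto simp: linear_add linear_scale)
  show ?thesis
  proof (rule that[of "Blinfun g"])
    show "norm (Blinfun g) \<le> 1"
      using abs by (intro norm_blinfun_bound) (auto simp: bounded_linear_Blinfun_apply[OF bl])
  qed (simp_all add: bounded_linear_Blinfun_apply[OF bl] g)
qed

lemma norming_functional:
  fixes x :: "'a::real_normed_vector"
  shows "\<exists>f :: 'a \<Rightarrow>\<^sub>L real. norm f \<le> 1 \<and> blinfun_apply f x = norm x"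
proof -
  have "sublinear (norm :: 'a \<Rightarrow> real)" by (auto simp: sublinear_def norm_triangle_ineq)
  from sublinear_norm_bounded_dominates[OF this order_refl] show ?thesis by metis
qed

text \<open>The distance to the subspace is a sublinear functional below the norm; a linear functional that it
dominates is nonpositive on the subspace, hence zero there, and can be made to equal the distance
at the given point.\<close>

lemma functional_vanishing_on_closed_subspace:
  fixes S :: "'a::real_normed_vector set"
  assumes S: "subspace S" "closed S" and x: "x \<notin> S"
  obtains f :: "'a \<Rightarrow>\<^sub>L real" where "\<And>s. s \<in> S \<Longrightarrow> blinfun_apply f s = 0" "blinfun_apply f x \<noteq> 0"
proof -
  have ne: "S \<noteq> {}" "0 \<in> S" using subspace_0[OF S(1)] by auto
  define p where "p x = infdist x S" for x
  have greatest: "m \<le> p x" if "\<And>s. s \<in> S \<Longrightarrow> m \<le> norm (x - s)" for m x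
    unfolding p_def infdist_notempty[OF ne(1)] using ne that by (intro cINF_greatest) (auto simp: dist_norm)
  have le: "p x \<le> norm (x - s)" if "s \<in> S" for x s
    using infdist_le[OF that] by (simp add: p_def dist_norm)
  have "sublinear p"
    unfolding sublinear_def
  proof (intro conjI allI impI)
    fix x y
    have *: "p (x + y) - norm (x - s) \<le> norm (y - t)" if "s \<in> S" "t \<in> S" for s t
      using le[OF subspace_add[OF S(1) that], of "x + y"] norm_triangle_ineq[of "x - s" "y - t"]
      by (simp add: algebra_simps)
    have "p (x + y) - norm (x - s) \<le> p y" if "s \<in> S" for s using that by (intro greatest *)
    then have "p (x + y) - p y \<le> p x" by (intro greatest) (smt (verit))
    then show "p (x + y) \<le> p x + p y" by simp
  next
    fix c :: real and x assume c: "0 \<le> c"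
    have *: "p (c *\<^sub>R x) \<le> c * norm (x - s)" if "s \<in> S" for s
      using le[OF subspace_scale[OF S(1) that, of c], of "c *\<^sub>R x"] c
      by (simp flip: scaleR_right_diff_distrib)
    show "p (c *\<^sub>R x) \<le> c * p x"
    proof (cases "c = 0")
      case True
      then show ?thesis using *[OF ne(2)] by simp
    next
      case False
      then have "p (c *\<^sub>R x) / c \<le> p x" using * c by (intro greatest) (simp add: field_simps)
      then show ?thesis using False c by (simp add: field_simps)
    qed
  qed
  then obtain f :: "'a \<Rightarrow>\<^sub>L real" where f: "\<And>y. blinfun_apply f y \<le> p y" "blinfun_apply f x = p x"
    using sublinear_norm_bounded_dominates[of p x] le[OF ne(2)] by (metis diff_zero)
  show ?thesis
  proof (rule that)
    fix s assume s: "s \<in> S"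
    then have "- s \<in> S" using S(1) by (simp add: subspace_neg)
    with s f(1)[of s] f(1)[of "- s"] show "blinfun_apply f s = 0"
      by (simp add: p_def blinfun.minus_right)
  next
    show "blinfun_apply f x \<noteq> 0"
      using f(2) infdist_pos_not_in_closed[OF S(2) ne(1) x] by (simp add: p_def)
  qed
qed

section \<open>Cech-complete spaces\<close>

lemma Hausdorff_space_stone_cech [simp]: "Hausdorff_space (stone_cech X)"
  unfolding stone_cech_def unit_cube_def
  by (intro Hausdorff_space_subtopology)
     (auto simp: Hausdorff_space_product_topology Hausdorff_space_subtopology)

lemma compact_space_stone_cech [simp]: "compact_space (stone_cech X)"
  unfolding stone_cech_def
proof (rule closedin_compact_space[THEN compact_space_subtopology])
  show "compact_space (unit_cube X)"
    unfolding unit_cube_def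
    by (auto simp: compact_space_product_topology compact_space_subtopology)
qed simp

lemma stone_cech_dense:
  assumes "completely_regular_space X" "Hausdorff_space X"
  shows "stone_cech X closure_of (stone_cech_map X ` topspace X) = topspace (stone_cech X)"
    and "stone_cech_map X ` topspace X \<subseteq> topspace (stone_cech X)"
proof -
  let ?P = "stone_cech_map X ` topspace X"
  show sub: "?P \<subseteq> topspace (stone_cech X)"
    using embedding_map_stone_cech[OF assms] homeomorphic_imp_surjective_map
    unfolding embedding_map_def by (metis inf.cobounded1 topspace_subtopology)
  then have "?P \<subseteq> unit_cube X closure_of ?P"
    by (auto simp: stone_cech_def)
  then show "stone_cech X closure_of ?P = topspace (stone_cech X)"
    by (simp add: stone_cech_def closure_of_subtopology Int_absorb1 closure_of_subset_topspace)
qed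

text \<open>By Lavrentiev's theorem the identity of \<open>P\<close> extends continuously to a \<open>G\<^sub>\<delta>\<close> set \<open>U\<close> with values in
\<open>P\<close>. On the dense set \<open>P\<close> the extension is the identity, so by the Hausdorff property it is the
identity on \<open>U\<close>, which means \<open>U = P\<close>.\<close>

lemma completely_metrizable_dense_imp_gdelta_in:
  assumes Z: "Hausdorff_space Z" and dense: "Z closure_of P = topspace Z" and sub: "P \<subseteq> topspace Z"
    and P: "completely_metrizable_space (subtopology Z P)"
  shows "gdelta_in Z P"
proof -
  obtain U f where "gdelta_in Z U" "P \<subseteq> U"
    and contf: "continuous_map (subtopology Z U) (subtopology Z P) f"
    and fid: "\<And>x. x \<in> P \<Longrightarrow> f x = x"
    using Lavrentiev_extension[of P Z "subtopology Z P" id] sub dense P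
    by (metis continuous_map_id id_apply order_refl)
  have UZ: "U \<subseteq> topspace Z" using \<open>gdelta_in Z U\<close> by (rule gdelta_in_subset)
  have fU: "f ` U \<subseteq> P"
    using continuous_map_image_subset_topspace[OF contf] UZ sub by (simp add: Int_absorb1)
  have "f x = x" if x: "x \<in> U" for x
  proof -
    have "x \<in> subtopology Z U closure_of P"
      using x dense UZ \<open>P \<subseteq> U\<close> by (auto simp: closure_of_subtopology Int_absorb1)
    moreover have "continuous_map (subtopology Z U) Z f" "continuous_map (subtopology Z U) Z (\<lambda>x. x)"
      using contf by (auto simp: continuous_map_in_subtopology continuous_map_from_subtopology)
    ultimately show ?thesis
      using forall_in_closure_of_eq[of x "subtopology Z U" P Z f "\<lambda>x. x"] Z fid by auto
  qed
  then have "U \<subseteq> P" using fU by force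
  with \<open>P \<subseteq> U\<close> \<open>gdelta_in Z U\<close> show ?thesis by auto
qed

lemma completely_metrizable_imp_cech_complete_space:
  assumes "completely_metrizable_space X"
  shows "cech_complete_space X"
proof -
  have m: "metrizable_space X" using assms by (rule completely_metrizable_imp_metrizable_space)
  have cr: "completely_regular_space X" "Hausdorff_space X"
    using m by (auto intro: metrizable_imp_completely_regular_space metrizable_imp_Hausdorff_space)
  let ?P = "stone_cech_map X ` topspace X"
  have "X homeomorphic_space subtopology (stone_cech X) ?P"
    using embedding_map_imp_homeomorphic_space[OF embedding_map_stone_cech[OF cr]] .
  then have "completely_metrizable_space (subtopology (stone_cech X) ?P)"
    using assms homeomorphic_completely_metrizable_space by blast
  then have "gdelta_in (stone_cech X) ?P"
    using stone_cech_dense[OF cr] by (intro completely_metrizable_dense_imp_gdelta_in) auto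
  then show ?thesis using cr by (simp add: cech_complete_space_def)
qed

text \<open>The internal form of Cech-completeness (Frolik, Arhangelskii): a decreasing sequence of nonempty sets
must have a cluster point once its members are small with respect to the successive covers. If the
space is \<open>\<Inter>n. G n\<close> in its compactification, the \<open>n\<close>-th cover consists of the traces of
the open sets whose closure lies in \<open>G n\<close>. Compactness gives a cluster point in the
compactification, and smallness puts it into every \<open>G n\<close>. The \<open>G\<^sub>\<delta>\<close> condition
enters the later arguments only in this form.\<close>

lemma cech_complete_space_covers:
  assumes "cech_complete_space X"
  obtains \<U> :: "nat \<Rightarrow> 'a set set"
  where "\<And>n U. U \<in> \<U> n \<Longrightarrow> openin X U" "\<And>n x. x \<in> topspace X \<Longrightarrow> \<exists>U\<in>\<U> n. x \<in> U"
    "\<And>A. (\<And>n. A n \<noteq> {}) \<Longrightarrow> decseq A \<Longrightarrow> (\<And>n. \<exists>U\<in>\<U> n. A n \<subseteq> U) \<Longrightarrow>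
       \<exists>x\<in>topspace X. \<forall>n. x \<in> X closure_of A n"
proof -
  have cr: "completely_regular_space X" "Hausdorff_space X"
    using assms by (auto simp: cech_complete_space_def)
  let ?Z = "stone_cech X" and ?e = "stone_cech_map X"
  define P where "P = ?e ` topspace X"
  have PZ: "P \<subseteq> topspace ?Z" unfolding P_def by (rule stone_cech_dense[OF cr])
  have hom: "homeomorphic_map X (subtopology ?Z P) ?e"
    using embedding_map_stone_cech[OF cr] by (simp add: embedding_map_def P_def)
  have cont: "continuous_map X ?Z ?e"
    using homeomorphic_imp_continuous_map[OF hom] by (simp add: continuous_map_in_subtopology)
  have "gdelta_in ?Z P"
    using assms by (simp add: cech_complete_space_def P_def)
  then obtain G :: "nat \<Rightarrow> _" where G: "\<And>n. openin ?Z (G n)" "(\<Inter>n. G n) = P"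
    by (auto simp: gdelta_in_descending)
  define \<U> where "\<U> n = {{x \<in> topspace X. ?e x \<in> W} | W. openin ?Z W \<and> ?Z closure_of W \<subseteq> G n}" for n
  show ?thesis
  proof (rule that[of \<U>])
    show "openin X U" if "U \<in> \<U> n" for n U
      using that cont by (auto simp: \<U>_def intro: openin_continuous_map_preimage)
  next
    fix n x assume x: "x \<in> topspace X"
    have "neighbourhood_base_of (closedin ?Z) ?Z"
      by (simp add: neighbourhood_base_of_closedin compact_Hausdorff_imp_regular_space)
    moreover have "?e x \<in> G n" using x G(2) by (auto simp: P_def)
    ultimately obtain W V where "openin ?Z W" "closedin ?Z V" "?e x \<in> W" "W \<subseteq> V" "V \<subseteq> G n"
      using G(1)[of n] unfolding neighbourhood_base_of by meson
    then have "openin ?Z W \<and> ?Z closure_of W \<subseteq> G n \<and> ?e x \<in> W"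
      by (meson closure_of_minimal order_trans)
    then show "\<exists>U\<in>\<U> n. x \<in> U" using x by (auto simp: \<U>_def)
  next
    fix A assume ne: "\<And>n. A n \<noteq> {}" and dec: "decseq A" and small: "\<And>n. \<exists>U\<in>\<U> n. A n \<subseteq> U"
    have AX: "A n \<subseteq> topspace X" for n using small[of n] by (auto simp: \<U>_def)
    have eAZ: "?e ` A n \<subseteq> topspace ?Z" for n using AX[of n] PZ by (auto simp: P_def)
    have "(\<Inter>n. ?Z closure_of (?e ` A n)) \<noteq> {}"
    proof (rule compact_space_imp_nest[OF compact_space_stone_cech closedin_closure_of])
      show "?Z closure_of (?e ` A n) \<noteq> {}" for n
        using closure_of_subset[OF eAZ[of n]] ne[of n] by auto
      show "decseq (\<lambda>n. ?Z closure_of (?e ` A n))"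
        using dec by (auto simp: decseq_def intro!: closure_of_mono image_mono)
    qed
    then obtain p where p: "\<And>n. p \<in> ?Z closure_of (?e ` A n)" by blast
    have "p \<in> G n" for n
    proof -
      obtain W where W: "?Z closure_of W \<subseteq> G n" "A n \<subseteq> {x \<in> topspace X. ?e x \<in> W}"
        using small[of n] by (auto simp: \<U>_def)
      then have "?e ` A n \<subseteq> W" by auto
      from closure_of_mono[OF this] show ?thesis using p[of n] W(1) by auto
    qed
    then have "p \<in> P" using G(2) by auto
    then obtain x where x: "x \<in> topspace X" "p = ?e x" by (auto simp: P_def)
    have "x \<in> X closure_of A n" for n
    proof -
      have "?e ` A n \<subseteq> P" using AX[of n] by (auto simp: P_def)
      then have "?e x \<in> subtopology ?Z P closure_of (?e ` A n)"
        using p[of n] \<open>p \<in> P\<close> x(2) by (auto simp: closure_of_subtopology Int_absorb1)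
      also have "\<dots> = ?e ` (X closure_of A n)"
        by (rule homeomorphic_map_closure_of[OF hom AX])
      finally obtain y where y: "y \<in> X closure_of A n" "?e x = ?e y" by auto
      moreover have "y \<in> topspace X" using y(1) closure_of_subset_topspace by fast
      ultimately show ?thesis
        using homeomorphic_imp_injective_map[OF hom] x(1) by (auto simp: inj_on_def)
    qed
    with x(1) show "\<exists>x\<in>topspace X. \<forall>n. x \<in> X closure_of A n" by blast
  qed
qed

text \<open>A point \<open>z\<close> of the closure belongs to \<open>P\<close> as soon as, for each \<open>n\<close>, some ball around \<open>z\<close> has a trace
on \<open>P\<close> that is small with respect to the \<open>n\<close>-th cover: the traces of shrinking balls then have a
cluster point in \<open>P\<close>, and it can only be \<open>z\<close>. These \<open>z\<close> form a \<open>G\<^sub>\<delta>\<close> set.\<close>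

lemma cech_complete_subset_imp_gdelta:
  fixes P :: "'b::metric_space set"
  assumes hom: "homeomorphic_map X (top_of_set P) \<phi>" and X: "cech_complete_space X"
  shows "gdelta_in euclidean P"
proof -
  obtain \<U> :: "nat \<Rightarrow> 'a set set" where U: "\<And>n U. U \<in> \<U> n \<Longrightarrow> openin X U"
    and cov: "\<And>n x. x \<in> topspace X \<Longrightarrow> \<exists>U\<in>\<U> n. x \<in> U"
    and cl: "\<And>A. (\<And>n. A n \<noteq> {}) \<Longrightarrow> decseq A \<Longrightarrow> (\<And>n. \<exists>U\<in>\<U> n. A n \<subseteq> U) \<Longrightarrow>
       \<exists>x\<in>topspace X. \<forall>n. x \<in> X closure_of A n"
    using cech_complete_space_covers[OF X] by metis
  have im: "\<phi> ` topspace X = P"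
    using homeomorphic_imp_surjective_map[OF hom] by simp
  have inj: "inj_on \<phi> (topspace X)" by (rule homeomorphic_imp_injective_map[OF hom])
  have cont: "continuous_map X euclidean \<phi>"
    using homeomorphic_imp_continuous_map[OF hom] by (simp add: continuous_map_in_subtopology)
  define O' where "O' n = \<Union>{W. open W \<and> (\<exists>U\<in>\<U> n. W \<inter> P \<subseteq> \<phi> ` U)}" for n
  have "P = closure P \<inter> (\<Inter>n. O' n)"
  proof (intro equalityI subsetI)
    fix z assume z: "z \<in> P"
    then obtain x where x: "x \<in> topspace X" "z = \<phi> x" using im by auto
    have "z \<in> O' n" for n
    proof -
      obtain U0 where U0: "U0 \<in> \<U> n" "x \<in> U0" using cov x by meson
      then have "openin (top_of_set P) (\<phi> ` U0)"
        using homeomorphic_imp_open_map[OF hom] U by (auto simp: open_map_def)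
      then obtain W where "open W" "\<phi> ` U0 = P \<inter> W" by (auto simp: openin_open)
      then show ?thesis using U0 x by (auto simp: O'_def)
    qed
    then show "z \<in> closure P \<inter> (\<Inter>n. O' n)" using z closure_subset by auto
  next
    fix z assume z: "z \<in> closure P \<inter> (\<Inter>n. O' n)"
    have "\<exists>e>0. \<exists>U\<in>\<U> n. ball z e \<inter> P \<subseteq> \<phi> ` U" for n
    proof -
      obtain W U0 where W: "open W" "z \<in> W" "U0 \<in> \<U> n" "W \<inter> P \<subseteq> \<phi> ` U0"
        using z unfolding O'_def by blast
      then obtain e where "e > 0" "ball z e \<subseteq> W" by (meson open_contains_ball)
      with W show ?thesis by blast
    qed
    then obtain e where e: "\<And>n. e n > 0" "\<And>n. \<exists>U\<in>\<U> n. ball z (e n) \<inter> P \<subseteq> \<phi> ` U" by metis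
    \<comment> \<open>The minimum over all earlier radii makes the balls decreasing, the reciprocal makes them shrink.\<close>
    define r where "r n = Min (insert (inverse (Suc n)) (e ` {..n}))" for n
    have r: "0 < r n" "r n \<le> e n" "r n \<le> inverse (Suc n)" for n
      using e(1) by (auto simp: r_def min.coboundedI2)
    have rdec: "r n \<le> r m" if "m \<le> n" for m n
    proof -
      have "r n \<le> inverse (Suc m)"
        using r(3)[of n] that by (smt (verit) le_imp_inverse_le of_nat_0_less_iff of_nat_mono Suc_le_mono zero_less_Suc)
      moreover have "r n \<le> e i" if "i \<le> m" for i
        unfolding r_def using that \<open>m \<le> n\<close> by (intro Min_le) auto
      ultimately show ?thesis unfolding r_def[of m] by auto
    qed
    define A where "A n = {x \<in> topspace X. \<phi> x \<in> ball z (r n)}" for n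
    have "\<exists>x\<in>topspace X. \<forall>n. x \<in> X closure_of A n"
    proof (rule cl)
      fix n
      obtain y where "y \<in> P" "dist y z < r n"
        using z r(1)[of n] by (meson IntD1 closure_approachable)
      then show "A n \<noteq> {}" using im by (auto simp: A_def dist_commute)
      obtain U0 where U0: "U0 \<in> \<U> n" "ball z (e n) \<inter> P \<subseteq> \<phi> ` U0" using e(2) by blast
      have "A n \<subseteq> U0"
      proof
        fix x assume "x \<in> A n"
        then have x: "x \<in> topspace X" "\<phi> x \<in> ball z (e n) \<inter> P"
          using r(2)[of n] im by (auto simp: A_def)
        then obtain u where "u \<in> U0" "\<phi> x = \<phi> u" using U0 by auto
        then show "x \<in> U0" using inj x(1) openin_subset[OF U[OF U0(1)]] by (auto simp: inj_on_def)
      qed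
      then show "\<exists>U\<in>\<U> n. A n \<subseteq> U" using U0 by blast
    next
      show "decseq A"
        using rdec by (fastforce simp: decseq_def A_def)
    qed
    then obtain x where x: "x \<in> topspace X" "\<And>n. x \<in> X closure_of A n" by blast
    have "dist z (\<phi> x) \<le> inverse (Suc n)" for n
    proof -
      have "closedin X {x \<in> topspace X. \<phi> x \<in> cball z (inverse (Suc n))}"
        by (rule closedin_continuous_map_preimage[OF cont]) simp
      moreover have "A n \<subseteq> {x \<in> topspace X. \<phi> x \<in> cball z (inverse (Suc n))}"
        using r(3)[of n] by (auto simp: A_def)
      ultimately show ?thesis
        using x(2)[of n] closure_of_minimal by fastforce
    qed
    then have "dist z (\<phi> x) \<le> 0"
      by (intro LIMSEQ_le_const[OF LIMSEQ_inverse_real_of_nat]) auto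
    then show "z \<in> P" using x(1) im by auto
  qed
  moreover have "gdelta_in euclidean (closure P)"
    using closed_imp_gdelta_in[of euclidean "closure P"] metrizable_space_euclidean by simp
  moreover have "gdelta_in euclidean (\<Inter>n. O' n)"
    by (intro gdelta_in_Inter open_imp_gdelta_in) (auto simp: O'_def)
  ultimately show ?thesis by (metis gdelta_in_Int)
qed

section \<open>Countable cs*-character and aleph-spaces\<close>

text \<open>The local condition behind countable \<open>cs\<^sup>*\<close>-character, tested on open neighbourhoods only.\<close>

definition cs_star_network_at :: "'a topology \<Rightarrow> 'a \<Rightarrow> 'a set set \<Rightarrow> bool" where
  "cs_star_network_at X x \<D> \<longleftrightarrow>
     (\<forall>s :: nat \<Rightarrow> 'a. \<forall>U. range s \<subseteq> topspace X \<longrightarrow> limitin X s x sequentially \<longrightarrow> openin X U \<longrightarrow> x \<in> U \<longrightarrow>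
        (\<exists>D\<in>\<D>. D \<subseteq> U \<and> infinite {n. s n \<in> D}))"

lemma cs_star_network_atI:
  assumes "\<And>s U. range s \<subseteq> topspace X \<Longrightarrow> limitin X s x sequentially \<Longrightarrow> openin X U \<Longrightarrow> x \<in> U \<Longrightarrow>
    \<exists>D\<in>\<D>. D \<subseteq> U \<and> infinite {n :: nat. s n \<in> D}"
  shows "cs_star_network_at X x \<D>"
  using assms by (simp add: cs_star_network_at_def)

lemma cs_star_network_atD:
  assumes "cs_star_network_at X x \<D>"
    "range s \<subseteq> topspace X" "limitin X s x sequentially" "openin X U" "x \<in> U"
  obtains D where "D \<in> \<D>" "D \<subseteq> U" "infinite {n :: nat. s n \<in> D}"
proof -
  have "\<exists>D\<in>\<D>. D \<subseteq> U \<and> infinite {n. s n \<in> D}"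
    using assms unfolding cs_star_network_at_def by simp
  then show ?thesis using that by (elim bexE conjE)
qed

lemma countable_cs_star_character_alt:
  "countable_cs_star_character X \<longleftrightarrow>
     (\<forall>x\<in>topspace X. \<exists>\<D>. countable \<D> \<and> \<D> \<subseteq> Pow (topspace X) \<and> cs_star_network_at X x \<D>)"
proof -
  have "(\<forall>s U. range s \<subseteq> topspace X \<and> limitin X s x sequentially \<and>
           U \<subseteq> topspace X \<and> (\<exists>V. openin X V \<and> x \<in> V \<and> V \<subseteq> U) \<longrightarrow>
           (\<exists>D \<in> \<D>. D \<subseteq> U \<and> infinite {n. s n \<in> D})) \<longleftrightarrow> cs_star_network_at X x \<D>" (is "?L \<longleftrightarrow> _") for x \<D>
  proof
    assume L: ?L
    show "cs_star_network_at X x \<D>"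
    proof (rule cs_star_network_atI)
      fix s :: "nat \<Rightarrow> 'a" and U
      assume "range s \<subseteq> topspace X" "limitin X s x sequentially" "openin X U" "x \<in> U"
      then show "\<exists>D\<in>\<D>. D \<subseteq> U \<and> infinite {n. s n \<in> D}"
        by (intro L[rule_format] conjI exI[of _ U]) (auto dest: openin_subset)
    qed
  next
    assume N: "cs_star_network_at X x \<D>"
    show ?L
    proof (intro allI impI, elim conjE exE)
      fix s :: "nat \<Rightarrow> 'a" and U V
      assume "range s \<subseteq> topspace X" "limitin X s x sequentially" "openin X V" "x \<in> V" "V \<subseteq> U"
      from N this(1-4) obtain D where "D \<in> \<D>" "D \<subseteq> V" "infinite {n. s n \<in> D}"
        by (rule cs_star_network_atD)
      with \<open>V \<subseteq> U\<close> show "\<exists>D\<in>\<D>. D \<subseteq> U \<and> infinite {n. s n \<in> D}"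
        by (intro bexI[of _ D]) auto
    qed
  qed
  then show ?thesis unfolding countable_cs_star_character_def by simp
qed

lemma countable_cs_star_character_subtopology:
  assumes "countable_cs_star_character X"
  shows "countable_cs_star_character (subtopology X S)"
  unfolding countable_cs_star_character_alt
proof
  fix x assume "x \<in> topspace (subtopology X S)"
  then have x: "x \<in> topspace X" "x \<in> S" by auto
  obtain \<D> where D: "countable \<D>" "\<D> \<subseteq> Pow (topspace X)" and net: "cs_star_network_at X x \<D>"
    using assms x(1) unfolding countable_cs_star_character_alt by blast
  have "cs_star_network_at (subtopology X S) x ((\<lambda>D. D \<inter> S) ` \<D>)"
  proof (rule cs_star_network_atI)
    fix s :: "nat \<Rightarrow> 'a" and U
    assume *: "range s \<subseteq> topspace (subtopology X S)" "limitin (subtopology X S) s x sequentially"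
      "openin (subtopology X S) U" "x \<in> U"
    then have s: "range s \<subseteq> topspace X" "\<And>n. s n \<in> S" and lim: "limitin X s x sequentially"
      by (auto simp: limitin_subtopology)
    obtain W where W: "openin X W" "U = W \<inter> S" using *(3) by (auto simp: openin_subtopology)
    have "x \<in> W" using W(2) *(4) by simp
    with net s(1) lim W(1) obtain D where D: "D \<in> \<D>" "D \<subseteq> W" "infinite {n. s n \<in> D}"
      by (rule cs_star_network_atD)
    have "infinite {n. s n \<in> D \<inter> S}" using s(2) D(3) by simp
    moreover have "D \<inter> S \<subseteq> U" using D(2) W(2) by blast
    ultimately show "\<exists>D\<in>(\<lambda>D. D \<inter> S) ` \<D>. D \<subseteq> U \<and> infinite {n. s n \<in> D}"
      using D(1) by blast
  qed
  moreover have "countable ((\<lambda>D. D \<inter> S) ` \<D>)" "(\<lambda>D. D \<inter> S) ` \<D> \<subseteq> Pow (topspace (subtopology X S))"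
    using D by auto
  ultimately show "\<exists>\<D>. countable \<D> \<and> \<D> \<subseteq> Pow (topspace (subtopology X S)) \<and>
      cs_star_network_at (subtopology X S) x \<D>"
    by blast
qed

text \<open>Keep the members of the \<open>\<sigma>\<close>-locally finite \<open>k\<close>-network whose closure contains \<open>x\<close>; local finiteness at
\<open>x\<close> leaves only finitely many of them in each locally finite layer. A convergent sequence together
with its limit is compact, so finitely many members of the \<open>k\<close>-network cover a tail of it inside a
given neighbourhood. One of them contains infinitely many terms, and \<open>x\<close> is then in its closure.\<close>

lemma aleph_space_imp_countable_cs_star_character:
  assumes "aleph_space X"
  shows "countable_cs_star_character X"
  unfolding countable_cs_star_character_alt
proof
  fix x assume x: "x \<in> topspace X"
  obtain \<N> where N: "k_network X \<N>" "sigma_locally_finite_in X \<N>"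
    using assms by (auto simp: aleph_space_def)
  then obtain \<A> :: "nat \<Rightarrow> 'a set set" where A: "\<And>n. locally_finite_in X (\<A> n)" "\<N> = (\<Union>n. \<A> n)"
    by (auto simp: sigma_locally_finite_in_def)
  define \<D> where "\<D> = (\<Union>n. {D \<in> \<A> n. x \<in> X closure_of D})"
  have "finite {D \<in> \<A> n. x \<in> X closure_of D}" for n
  proof -
    obtain V where V: "openin X V" "x \<in> V" "finite {U \<in> \<A> n. U \<inter> V \<noteq> {}}"
      using A(1)[of n] x by (auto simp: locally_finite_in_def)
    have "{D \<in> \<A> n. x \<in> X closure_of D} \<subseteq> {U \<in> \<A> n. U \<inter> V \<noteq> {}}"
      using V(1,2) by (auto simp: in_closure_of)
    then show ?thesis using V(3) by (rule finite_subset)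
  qed
  then have "countable \<D>" unfolding \<D>_def by (intro countable_UN) (auto intro: countable_finite)
  moreover have "\<D> \<subseteq> Pow (topspace X)"
    using N(1) A(2) by (auto simp: \<D>_def k_network_def)
  moreover have "cs_star_network_at X x \<D>"
  proof (rule cs_star_network_atI)
    fix s :: "nat \<Rightarrow> 'a" and U
    assume s: "range s \<subseteq> topspace X" "limitin X s x sequentially" and U: "openin X U" "x \<in> U"
    then obtain m where m: "\<And>n. n \<ge> m \<Longrightarrow> s n \<in> U" unfolding limitin_sequentially by blast
    define K where "K = insert x (s ` {m..})"
    have "compactin X K"
      unfolding K_def using s by (intro compactin_sequence_with_limit[OF s(2)]) auto
    moreover have "K \<subseteq> U" using m U(2) by (auto simp: K_def)
    ultimately obtain \<F> where F: "finite \<F>" "\<F> \<subseteq> \<N>" "K \<subseteq> \<Union>\<F>" "\<Union>\<F> \<subseteq> U"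
      using N(1) U(1) unfolding k_network_def by metis
    have "infinite (\<Union>D\<in>\<F>. {n. s n \<in> D})"
    proof
      assume "finite (\<Union>D\<in>\<F>. {n. s n \<in> D})"
      moreover have "{m..} \<subseteq> (\<Union>D\<in>\<F>. {n. s n \<in> D})" using F(3) by (auto simp: K_def)
      ultimately show False using finite_subset infinite_Ici by blast
    qed
    then obtain D where D: "D \<in> \<F>" "infinite {n. s n \<in> D}" using F(1) by blast
    have "x \<in> X closure_of D"
      unfolding in_closure_of
    proof (intro conjI allI impI)
      fix T assume T: "x \<in> T \<and> openin X T"
      then obtain k where k: "\<And>n. n \<ge> k \<Longrightarrow> s n \<in> T" using s(2) unfolding limitin_sequentially by blast
      obtain n where "n \<ge> k" "s n \<in> D"
        using D(2) unfolding infinite_nat_iff_unbounded_le by blast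
      with k show "\<exists>y. y \<in> D \<and> y \<in> T" by blast
    qed (rule x)
    then have "D \<in> \<D>" using D(1) F(2) A(2) by (auto simp: \<D>_def)
    moreover have "D \<subseteq> U" using D(1) F(4) by blast
    ultimately show "\<exists>D\<in>\<D>. D \<subseteq> U \<and> infinite {n. s n \<in> D}" using D(2) by blast
  qed
  ultimately show "\<exists>\<D>. countable \<D> \<and> \<D> \<subseteq> Pow (topspace X) \<and> cs_star_network_at X x \<D>" by blast
qed

text \<open>A countable base is a \<open>k\<close>-network, and a countable family is a union of singletons, which are locally
finite.\<close>

lemma second_countable_imp_aleph_space:
  assumes "regular_space X" "t1_space X" "second_countable X"
  shows "aleph_space X"
proof -
  obtain \<B> where B: "countable \<B>" "\<And>V. V \<in> \<B> \<Longrightarrow> openin X V"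
    and base: "\<And>U x. openin X U \<Longrightarrow> x \<in> U \<Longrightarrow> \<exists>V\<in>\<B>. x \<in> V \<and> V \<subseteq> U"
    using assms(3) unfolding second_countable_def by metis
  define \<N> where "\<N> = insert {} \<B>"
  have N: "countable \<N>" "\<N> \<noteq> {}" "\<And>V. V \<in> \<N> \<Longrightarrow> openin X V" using B by (auto simp: \<N>_def)
  have "k_network X \<N>"
    unfolding k_network_def
  proof (intro conjI allI impI)
    show "\<N> \<subseteq> Pow (topspace X)" using N(3) openin_subset by blast
  next
    fix U K assume UK: "openin X U \<and> compactin X K \<and> K \<subseteq> U"
    let ?\<C> = "{V \<in> \<N>. V \<subseteq> U}"
    have "K \<subseteq> \<Union>?\<C>" using UK base by (fastforce simp: \<N>_def)
    then obtain \<F> where "finite \<F>" "\<F> \<subseteq> ?\<C>" "K \<subseteq> \<Union>\<F>"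
      using UK N(3) unfolding compactin_def by (metis (no_types, lifting) mem_Collect_eq)
    then show "\<exists>\<F>. finite \<F> \<and> \<F> \<subseteq> \<N> \<and> K \<subseteq> \<Union>\<F> \<and> \<Union>\<F> \<subseteq> U"
      by (intro exI[of _ \<F>]) auto
  qed
  moreover have "sigma_locally_finite_in X \<N>"
    unfolding sigma_locally_finite_in_def
  proof (intro exI conjI allI)
    fix n
    have "from_nat_into \<N> n \<in> \<N>" by (rule from_nat_into[OF N(2)])
    then show "locally_finite_in X {from_nat_into \<N> n}"
      using N(3) openin_subset by (intro finite_imp_locally_finite_in) auto
  next
    show "\<N> = (\<Union>n. {from_nat_into \<N> n})"
      using range_from_nat_into[OF N(2,1)] by auto
  qed
  ultimately show ?thesis using assms by (auto simp: aleph_space_def)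
qed

lemma separable_metrizable_imp_second_countable:
  assumes "metrizable_space X" "separable_space X"
  shows "second_countable X"
proof -
  obtain M d where "Metric_space M d" and X: "X = Metric_space.mtopology M d"
    using assms(1) by (auto simp: metrizable_space_def)
  interpret Metric_space M d by fact
  obtain C where C: "countable C" "C \<subseteq> M" "mtopology closure_of C = M"
    using assms(2) by (auto simp: separable_space_def X)
  define \<B> where "\<B> = (\<lambda>(c, n). mball c (inverse (real (Suc n)))) ` (C \<times> UNIV)"
  show ?thesis
    unfolding second_countable_def
  proof (intro exI[of _ \<B>] conjI allI impI ballI)
    show "countable \<B>" unfolding \<B>_def using C(1) by (intro countable_image countable_SIGMA) auto
    show "openin X V" if "V \<in> \<B>" for V using that by (auto simp: \<B>_def X)
  next
    fix U x assume "openin X U \<and> x \<in> U"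
    then obtain r where r: "0 < r" "mball x r \<subseteq> U" and x: "x \<in> M"
      unfolding X openin_mtopology by blast
    obtain n where n: "inverse (real (Suc n)) < r / 2"
      using r(1) reals_Archimedean[of "r / 2"] by auto
    have "x \<in> mtopology closure_of C" using C(3) x by simp
    moreover have "0 < inverse (real (Suc n))" by simp
    ultimately obtain c where c: "c \<in> C" "c \<in> mball x (inverse (real (Suc n)))"
      unfolding metric_closure_of by blast
    then have d: "d x c < inverse (real (Suc n))" "c \<in> M" by (simp_all del: of_nat_Suc)
    have "mball c (inverse (real (Suc n))) \<subseteq> mball x r"
    proof
      fix y assume "y \<in> mball c (inverse (real (Suc n)))"
      then have "d c y < inverse (real (Suc n))" "y \<in> M" by (simp_all del: of_nat_Suc)
      then show "y \<in> mball x r" using triangle[of x c y] x d n by (simp del: of_nat_Suc)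
    qed
    moreover have "x \<in> mball c (inverse (real (Suc n)))"
      using d x by (simp add: commute[of c x] del: of_nat_Suc)
    ultimately show "\<exists>V\<in>\<B>. x \<in> V \<and> V \<subseteq> U"
      using c(1) r(2) by (intro bexI[of _ "mball c (inverse (real (Suc n)))"]) (auto simp: \<B>_def)
  qed
qed

lemma polish_imp_aleph_space:
  assumes "polish_space_top X"
  shows "aleph_space X"
proof -
  have m: "metrizable_space X"
    using assms by (simp add: polish_space_top_def completely_metrizable_imp_metrizable_space)
  moreover have "second_countable X"
    using assms m separable_metrizable_imp_second_countable by (auto simp: polish_space_top_def)
  ultimately show ?thesis
    by (intro second_countable_imp_aleph_space metrizable_imp_regular_space
        Hausdorff_imp_t1_space metrizable_imp_Hausdorff_space)
qed

section \<open>The weak topology\<close>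

lemma continuous_map_weak_functional:
  "continuous_map weak_topology euclideanreal (blinfun_apply (f :: 'a::real_normed_vector \<Rightarrow>\<^sub>L real))"
proof -
  have "openin weak_topology (blinfun_apply f -` U)" if "open U" for U
    unfolding weak_topology_def using that by (intro topology_generated_by_Basis) blast
  then show ?thesis by (simp add: continuous_map_def vimage_def)
qed

lemma continuous_map_into_weak:
  assumes "\<And>f :: 'b::real_normed_vector \<Rightarrow>\<^sub>L real. continuous_map X euclideanreal (\<lambda>x. blinfun_apply f (h x))"
  shows "continuous_map X weak_topology h"
  unfolding weak_topology_def
proof (rule continuous_on_generated_topo)
  fix W assume "W \<in> {blinfun_apply f -` U | (f :: 'b \<Rightarrow>\<^sub>L real) U. open U}"
  then obtain f :: "'b \<Rightarrow>\<^sub>L real" and U where W: "W = blinfun_apply f -` U" "open U" by blast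
  have "openin X {x \<in> topspace X. blinfun_apply f (h x) \<in> U}"
    using W(2) by (intro openin_continuous_map_preimage[OF assms]) simp
  moreover have "{x \<in> topspace X. blinfun_apply f (h x) \<in> U} = h -` W \<inter> topspace X"
    by (auto simp: W(1))
  ultimately show "openin X (h -` W \<inter> topspace X)" by simp
next
  show "h ` topspace X \<subseteq> \<Union>{blinfun_apply f -` U | (f :: 'b \<Rightarrow>\<^sub>L real) U. open U}"
    using topspace_weak_topology[where 'a = 'b] unfolding weak_topology_def topology_generated_by_topspace
    by auto
qed

lemma continuous_map_weak_affine:
  "continuous_map weak_topology weak_topology (\<lambda>y :: 'a::real_normed_vector. x + c *\<^sub>R y)"
proof (rule continuous_map_into_weak)
  fix f :: "'a \<Rightarrow>\<^sub>L real"
  show "continuous_map weak_topology euclideanreal (\<lambda>y. blinfun_apply f (x + c *\<^sub>R y))"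
    unfolding blinfun.add_right blinfun.scaleR_right real_scaleR_def
    by (intro continuous_intros continuous_map_weak_functional)
qed

lemma continuous_map_ball_functional:
  "continuous_map weak_unit_ball euclideanreal (blinfun_apply (f :: 'a::real_normed_vector \<Rightarrow>\<^sub>L real))"
  unfolding weak_unit_ball_def by (intro continuous_map_from_subtopology continuous_map_weak_functional)

text \<open>Sets with this property at each of their points are closed under the operations that generate the
topology from its subbase.\<close>

lemma weak_neighbourhood_functionals:
  fixes U :: "'a::real_normed_vector set"
  assumes "openin weak_topology U" "x \<in> U"
  obtains F :: "('a \<Rightarrow>\<^sub>L real) set" and e where "finite F" "0 < e"
    "{y. \<forall>f\<in>F. \<bar>blinfun_apply f (y - x)\<bar> < e} \<subseteq> U"
proof -
  define N where "N F e = {y. \<forall>f\<in>F. \<bar>blinfun_apply f (y - x)\<bar> < e}" for F :: "('a \<Rightarrow>\<^sub>L real) set" and e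
  have "generate_topology_on {blinfun_apply f -` U | (f :: 'a \<Rightarrow>\<^sub>L real) U. open U} U"
    using assms(1) by (simp add: weak_topology_def openin_topology_generated_by_iff)
  then have "x \<in> U \<Longrightarrow> \<exists>F e. finite F \<and> 0 < e \<and> N F e \<subseteq> U"
  proof (induction rule: generate_topology_on.induct)
    case (Int a b)
    then have "\<exists>F e. finite F \<and> 0 < e \<and> N F e \<subseteq> a" "\<exists>F e. finite F \<and> 0 < e \<and> N F e \<subseteq> b"
      by simp_all
    then obtain F e G d where *: "finite F" "0 < e" "N F e \<subseteq> a" "finite G" "0 < d" "N G d \<subseteq> b"
      by (elim exE conjE)
    have "N (F \<union> G) (min e d) \<subseteq> N F e \<inter> N G d" by (auto simp: N_def)
    with * show ?case
      by (intro exI[of _ "F \<union> G"] exI[of _ "min e d"]) auto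
  next
    case (UN K)
    then obtain k where k: "k \<in> K" "x \<in> k" by (elim UnionE)
    with UN.IH have "\<exists>F e. finite F \<and> 0 < e \<and> N F e \<subseteq> k" by simp
    with k(1) show ?case by (meson Union_upper order_trans)
  next
    case (Basis s)
    then obtain f :: "'a \<Rightarrow>\<^sub>L real" and V where V: "s = blinfun_apply f -` V" "open V" by blast
    then obtain e where e: "0 < e" "ball (blinfun_apply f x) e \<subseteq> V"
      using Basis.prems by (metis open_contains_ball vimageE)
    have "N {f} e \<subseteq> s"
      using e(2) by (auto simp: N_def V subset_eq dist_real_def blinfun.diff_right abs_minus_commute)
    with e(1) show ?case by (intro exI[of _ "{f}"] exI[of _ e]) simp
  qed simp
  then obtain F e where "finite F" "0 < e" "N F e \<subseteq> U" using assms(2) by auto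
  then show ?thesis using that by (simp add: N_def)
qed

lemma limitin_weak_functional:
  assumes "limitin weak_topology s x F"
  shows "((\<lambda>n. blinfun_apply f (s n)) \<longlongrightarrow> blinfun_apply (f :: 'a::real_normed_vector \<Rightarrow>\<^sub>L real) x) F"
  using continuous_map_limit[OF continuous_map_weak_functional[of f] assms] by (simp add: o_def)

text \<open>The uniform boundedness principle for points acting on the dual space: Baire's theorem in the dual
yields a ball of functionals on which \<open>S\<close> is uniformly bounded, and norming functionals turn this
into a bound on the norms.\<close>

lemma weakly_bounded_imp_bounded:
  fixes S :: "'a::real_normed_vector set"
  assumes "\<And>f :: 'a \<Rightarrow>\<^sub>L real. bounded (blinfun_apply f ` S)"
  shows "bounded S"
proof -
  define C where "C k = {f :: 'a \<Rightarrow>\<^sub>L real. \<forall>s\<in>S. \<bar>blinfun_apply f s\<bar> \<le> real k}" for k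
  have closed: "closed (C k)" for k
  proof -
    have "C k = (\<Inter>s\<in>S. {f. \<bar>blinfun_apply f s\<bar> \<le> real k})" by (auto simp: C_def)
    then show ?thesis
      by (auto intro!: closed_INT closed_Collect_le continuous_intros)
  qed
  have "f \<in> (\<Union>k. C k)" for f
  proof -
    obtain b where "\<And>s. s \<in> S \<Longrightarrow> \<bar>blinfun_apply f s\<bar> \<le> b"
      using assms[of f] by (auto simp: bounded_iff)
    moreover obtain k where "b \<le> real k" using real_arch_simple by blast
    ultimately have "f \<in> C k" unfolding C_def by force
    then show ?thesis by blast
  qed
  then have "interior (\<Union>(range C)) \<noteq> {}"
    by (simp add: UNIV_eq_I[of "\<Union>(range C)", symmetric])
  then obtain k where "interior (C k) \<noteq> {}"
    using Baire_category_alt[of "euclidean :: ('a \<Rightarrow>\<^sub>L real) topology" "range C"] closed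
      completely_metrizable_space_euclidean by auto
  then obtain f e where e: "0 < e" "cball f e \<subseteq> C k"
    by (metis ex_in_conv mem_interior_cball)
  have "norm s \<le> 2 * real k / e" if s: "s \<in> S" for s
  proof -
    obtain h :: "'a \<Rightarrow>\<^sub>L real" where h: "norm h \<le> 1" "blinfun_apply h s = norm s"
      using norming_functional by blast
    have "f \<in> C k" "f + e *\<^sub>R h \<in> C k"
      using e h(1) by (auto intro!: subsetD[OF e(2)] simp: dist_norm mult_le_cancel_left2)
    then have "\<bar>blinfun_apply f s\<bar> \<le> k" "\<bar>blinfun_apply (f + e *\<^sub>R h) s\<bar> \<le> k"
      using s by (auto simp: C_def)
    then have "e * norm s \<le> 2 * k"
      by (simp add: blinfun.add_left blinfun.scaleR_left h(2))
    then show ?thesis using e(1) by (simp add: field_simps)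
  qed
  then show ?thesis by (auto simp: bounded_iff)
qed

text \<open>A sequence that converges weakly to \<open>x\<close> is bounded, so it lies in \<open>x + k B\<close> for some natural
number \<open>k\<close>. Hence the images of a network at \<open>0\<close> in the ball under the countably many maps
\<open>y \<mapsto> x + k y\<close> form a network at \<open>x\<close>.\<close>

lemma countable_cs_star_character_weak_from_ball:
  assumes "countable_cs_star_character (weak_unit_ball :: 'a::real_normed_vector topology)"
  shows "countable_cs_star_character (weak_topology :: 'a topology)"
  unfolding countable_cs_star_character_alt
proof
  fix x :: 'a
  let ?B = "weak_unit_ball :: 'a topology"
  have "0 \<in> topspace ?B" by simp
  then obtain \<D> where D: "countable \<D>" and net: "cs_star_network_at ?B 0 \<D>"
    using assms unfolding countable_cs_star_character_alt by blast
  define blow :: "nat \<Rightarrow> 'a \<Rightarrow> 'a" where "blow k y = x + real k *\<^sub>R y" for k y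
  have "cs_star_network_at weak_topology x (\<Union>k. (`) (blow k) ` \<D>)"
  proof (rule cs_star_network_atI)
    fix s :: "nat \<Rightarrow> 'a" and U
    assume lim: "limitin weak_topology s x sequentially"
      and V: "openin weak_topology U" "x \<in> U"
    have "bounded (range s)"
    proof (rule weakly_bounded_imp_bounded)
      fix f :: "'a \<Rightarrow>\<^sub>L real"
      have "Bseq (\<lambda>n. blinfun_apply f (s n))"
        using limitin_weak_functional[OF lim] by (intro convergent_imp_Bseq convergentI)
      then show "bounded (blinfun_apply f ` range s)"
        by (simp add: Bseq_eq_bounded image_image)
    qed
    then have "bounded (range (\<lambda>n. s n - x))"
      using bounded_minus_comp[of s UNIV "\<lambda>_. x"] by simp
    then obtain b where b: "\<And>n. norm (s n - x) \<le> b" unfolding bounded_iff by blast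
    obtain k :: nat where "b \<le> real k" using real_arch_simple by blast
    then have k: "norm (s n - x) \<le> real (Suc k)" for n using b[of n] by simp
    define t where "t n = inverse (real (Suc k)) *\<^sub>R (s n - x)" for n
    have blow_t: "blow (Suc k) (t n) = s n" for n by (simp add: blow_def t_def del: of_nat_Suc)
    have t: "t n \<in> cball 0 1" for n
    proof -
      have "norm (t n) = norm (s n - x) / real (Suc k)"
        by (simp add: t_def divide_inverse_commute del: of_nat_Suc)
      also have "\<dots> \<le> 1" using k[of n] by (simp add: divide_le_eq_1 del: of_nat_Suc)
      finally show ?thesis by simp
    qed
    have "limitin weak_topology ((\<lambda>y. - inverse (real (Suc k)) *\<^sub>R x + inverse (real (Suc k)) *\<^sub>R y) \<circ> s)
       (- inverse (real (Suc k)) *\<^sub>R x + inverse (real (Suc k)) *\<^sub>R x) sequentially"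
      by (rule continuous_map_limit[OF continuous_map_weak_affine lim])
    then have "limitin weak_topology t 0 sequentially"
      by (simp add: o_def t_def[abs_def] scaleR_right_diff_distrib del: of_nat_Suc)
    then have lim_t: "limitin ?B t 0 sequentially"
      using t by (simp add: weak_unit_ball_def limitin_subtopology)
    define U' where "U' = {y \<in> cball 0 1. blow (Suc k) y \<in> U}"
    have "openin weak_topology {y. blow (Suc k) y \<in> U}"
      using openin_continuous_map_preimage[OF continuous_map_weak_affine[of x "real (Suc k)"] V(1)]
      unfolding blow_def by simp
    then have "openin ?B U'"
      unfolding weak_unit_ball_def openin_subtopology U'_def by (intro exI conjI) auto
    moreover have "0 \<in> U'" using V(2) by (simp add: U'_def blow_def)
    moreover have "range t \<subseteq> topspace ?B" using t by auto
    ultimately obtain D where D: "D \<in> \<D>" "D \<subseteq> U'" "infinite {n. t n \<in> D}"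
      using cs_star_network_atD[OF net _ lim_t] by blast
    have "s n \<in> blow (Suc k) ` D" if "t n \<in> D" for n
      using imageI[OF that, of "blow (Suc k)"] by (simp only: blow_t)
    then have "{n. t n \<in> D} \<subseteq> {n. s n \<in> blow (Suc k) ` D}" by auto
    then have "infinite {n. s n \<in> blow (Suc k) ` D}" using D(3) by (rule infinite_super)
    moreover have "blow (Suc k) ` D \<subseteq> U" using D(2) by (auto simp: U'_def)
    ultimately show "\<exists>D\<in>\<Union>k. (`) (blow k) ` \<D>. D \<subseteq> U \<and> infinite {n. s n \<in> D}"
      using D(1) by (intro bexI[of _ "blow (Suc k) ` D"] UN_I[of "Suc k"] conjI imageI) simp_all
  qed
  moreover have "countable (\<Union>k. (`) (blow k) ` \<D>)" using D by simp
  ultimately show "\<exists>\<D>. countable \<D> \<and> \<D> \<subseteq> Pow (topspace weak_topology) \<and> cs_star_network_at weak_topology x \<D>"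
    unfolding topspace_weak_topology by blast
qed

section \<open>Selecting weakly null sequences\<close>

lemma subspace_closure_of_rational_subspace:
  fixes T :: "'a::real_normed_vector set"
  assumes zero: "0 \<in> T" and add: "\<And>a b. a \<in> T \<Longrightarrow> b \<in> T \<Longrightarrow> a + b \<in> T"
    and scale: "\<And>q a. q \<in> \<rat> \<Longrightarrow> a \<in> T \<Longrightarrow> q *\<^sub>R a \<in> T"
  shows "subspace (closure T)"
proof (rule subspaceI)
  show "0 \<in> closure T" using zero closure_subset by auto
next
  fix x y assume "x \<in> closure T" "y \<in> closure T"
  then obtain a b where "\<And>n. a n \<in> T" "a \<longlonglongrightarrow> x" "\<And>n. b n \<in> T" "b \<longlonglongrightarrow> y"
    unfolding closure_sequential by metis
  then have "\<forall>n. a n + b n \<in> T" "(\<lambda>n. a n + b n) \<longlonglongrightarrow> x + y"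
    by (auto intro: add tendsto_add)
  then show "x + y \<in> closure T" unfolding closure_sequential by (intro exI[of _ "\<lambda>n. a n + b n"]) simp
next
  fix c :: real and x assume "x \<in> closure T"
  then obtain a where a: "\<And>n. a n \<in> T" "a \<longlonglongrightarrow> x"
    unfolding closure_sequential by metis
  have "c \<in> closure \<rat>" by (simp add: Rats_closure_real)
  then obtain q where q: "\<And>n. q n \<in> \<rat>" "q \<longlonglongrightarrow> c"
    unfolding closure_sequential by metis
  have "\<forall>n. q n *\<^sub>R a n \<in> T" "(\<lambda>n. q n *\<^sub>R a n) \<longlonglongrightarrow> c *\<^sub>R x"
    using a q by (auto intro: scale tendsto_scaleR)
  then show "c *\<^sub>R x \<in> closure T" unfolding closure_sequential by (intro exI[of _ "\<lambda>n. q n *\<^sub>R a n"]) simp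
qed

text \<open>Finite sets that exhaust the rational span of the vectors \<open>pick n (span_stage pick n)\<close>, chosen one
after another. The choice of the next vector may depend on the stage reached so far, which is what
the selection below needs: each new vector must be nearly annihilated by functionals that norm the
span of the earlier ones. The closure under scaling is spread over the stages by an enumeration of
the rational numbers.\<close>

fun span_stage :: "(nat \<Rightarrow> 'a set \<Rightarrow> 'a) \<Rightarrow> nat \<Rightarrow> 'a::real_vector set" where
  "span_stage pick 0 = {0}"
| "span_stage pick (Suc n) =
     insert (pick n (span_stage pick n)) (span_stage pick n)
     \<union> (\<lambda>(a, b). a + b) ` (span_stage pick n \<times> span_stage pick n)
     \<union> (\<lambda>(i, a). from_nat_into \<rat> i *\<^sub>R a) ` ({..n} \<times> span_stage pick n)"

lemma finite_span_stage: "finite (span_stage pick n)"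
  by (induction n) auto

lemma span_stage_mono: "m \<le> n \<Longrightarrow> span_stage pick m \<subseteq> span_stage pick n"
  by (rule lift_Suc_mono_le[of "span_stage pick"]) auto

lemma subspace_closure_span_stages: "subspace (closure (\<Union>n. span_stage pick n))"
  for pick :: "nat \<Rightarrow> 'a::real_normed_vector set \<Rightarrow> 'a"
proof (rule subspace_closure_of_rational_subspace)
  have "0 \<in> span_stage pick 0" by simp
  then show "0 \<in> (\<Union>n. span_stage pick n)" by blast
next
  fix a b assume "a \<in> (\<Union>n. span_stage pick n)" "b \<in> (\<Union>n. span_stage pick n)"
  then obtain m n where "a \<in> span_stage pick m" "b \<in> span_stage pick n" by blast
  then have "a \<in> span_stage pick (max m n)" "b \<in> span_stage pick (max m n)"
    using span_stage_mono[of m "max m n" pick] span_stage_mono[of n "max m n" pick] by auto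
  then have "a + b \<in> span_stage pick (Suc (max m n))" by force
  then show "a + b \<in> (\<Union>n. span_stage pick n)" by blast
next
  fix q :: real and a assume q: "q \<in> \<rat>" and "a \<in> (\<Union>n. span_stage pick n)"
  then obtain m where "a \<in> span_stage pick m" by blast
  obtain i where i: "q = from_nat_into \<rat> i"
    using q countable_rat by (metis from_nat_into_surj)
  have "a \<in> span_stage pick (max i m)"
    using \<open>a \<in> span_stage pick m\<close> span_stage_mono[of m "max i m" pick] by auto
  then have "q *\<^sub>R a \<in> span_stage pick (Suc (max i m))" unfolding i by force
  then show "q *\<^sub>R a \<in> (\<Union>n. span_stage pick n)" by blast
qed

text \<open>This replaces the Eberlein-Smulian theorem and follows Whitley's proof of it. Choose \<open>x n \<in> A n\<close>
inside fixed neighbourhoods of \<open>0\<close> from the covers up to the \<open>n\<close>-th, and such that functionals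
norming the vectors of the \<open>n\<close>-th stage have absolute value below \<open>1 / (n + 1)\<close> at \<open>x n\<close>. Let \<open>z\<close> be a weak cluster point of the sequence.
Then \<open>z\<close> lies in the norm-closed span of the \<open>x n\<close>, because a closed subspace is weakly closed,
and all the norming functionals vanish at \<open>z\<close>. If \<open>t\<close> in the rational span is close to \<open>z\<close>, then
\<open>norm t = J t (t - z) \<le> norm (t - z)\<close>, so \<open>z = 0\<close>. If the sequence stayed outside a neighbourhood
of \<open>0\<close> infinitely often, the covers would provide a cluster point outside that neighbourhood.\<close>

lemma weak_ball_sequence_selection:
  fixes A :: "nat \<Rightarrow> 'a::real_normed_vector set"
  assumes cech: "cech_complete_space (weak_unit_ball :: 'a topology)"
    and A: "\<And>n. 0 \<in> weak_unit_ball closure_of A n"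
  obtains x where "\<And>n. x n \<in> A n" "\<And>n. x n \<in> cball 0 1" "limitin weak_unit_ball x 0 sequentially"
proof -
  let ?B = "weak_unit_ball :: 'a topology"
  obtain \<U> :: "nat \<Rightarrow> 'a set set" where U: "\<And>n U. U \<in> \<U> n \<Longrightarrow> openin ?B U"
    and cov: "\<And>n x. x \<in> topspace ?B \<Longrightarrow> \<exists>U\<in>\<U> n. x \<in> U"
    and cl: "\<And>A. (\<And>n. A n \<noteq> {}) \<Longrightarrow> decseq A \<Longrightarrow> (\<And>n. \<exists>U\<in>\<U> n. A n \<subseteq> U) \<Longrightarrow>
       \<exists>x\<in>topspace ?B. \<forall>n. x \<in> ?B closure_of A n"
    by (rule cech_complete_space_covers[OF cech]) (assumption | blast)+
  have "\<exists>U\<in>\<U> n. 0 \<in> U" for n using cov[of 0 n] by simp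
  then obtain U0 where U0: "\<And>n. U0 n \<in> \<U> n" "\<And>n. 0 \<in> U0 n" by metis
  obtain J :: "'a \<Rightarrow> 'a \<Rightarrow>\<^sub>L real" where J: "\<And>t. norm (J t) \<le> 1" "\<And>t. blinfun_apply (J t) t = norm t"
    using norming_functional by metis
  define good where "good n T x \<longleftrightarrow> x \<in> A n \<and> (\<forall>i\<le>n. x \<in> U0 i) \<and>
    (\<forall>t\<in>T. \<bar>blinfun_apply (J t) x\<bar> < inverse (Suc n))" for n T x
  have ex: "\<exists>x. good n T x" if T: "finite T" for n T
  proof -
    define Z where "Z = (\<Inter>t\<in>T. {x \<in> topspace ?B. blinfun_apply (J t) x \<in> {- inverse (Suc n)<..<inverse (Suc n)}})"
    define W where "W = (\<Inter>i\<in>{..n}. U0 i) \<inter> (Z \<inter> topspace ?B)"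
    have "openin ?B (Z \<inter> topspace ?B)"
      unfolding Z_def
      by (intro openin_INT[OF T] openin_continuous_map_preimage[OF continuous_map_ball_functional])
         (simp flip: open_openin)
    moreover have "openin ?B (\<Inter>i\<in>{..n}. U0 i)"
      by (intro openin_INT2) (auto intro: U U0)
    ultimately have "openin ?B W" unfolding W_def by (rule openin_Int[rotated])
    moreover have "0 \<in> W" by (simp add: W_def Z_def U0)
    ultimately obtain x where "x \<in> A n" "x \<in> W"
      using A[of n] unfolding in_closure_of by blast
    then have "good n T x" by (auto simp: good_def W_def Z_def abs_less_iff)
    then show ?thesis ..
  qed
  define pick where "pick n T = (SOME x. good n T x)" for n T
  define T where "T = span_stage pick"
  define x where "x n = pick n (T n)" for n
  define T' where "T' = (\<Union>n. T n)"
  have good: "good n (T n) (x n)" for n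
    unfolding x_def pick_def T_def by (rule someI_ex[OF ex[OF finite_span_stage]])
  have xA: "x n \<in> A n" and xU: "i \<le> n \<Longrightarrow> x n \<in> U0 i"
    and xJ: "t \<in> T n \<Longrightarrow> \<bar>blinfun_apply (J t) (x n)\<bar> < inverse (Suc n)" for n i t
    using good[of n] by (auto simp: good_def)
  have xB: "x n \<in> cball 0 1" for n
    using xU[of 0 n] openin_subset[OF U[OF U0(1)[of 0]]] by auto
  have xT: "x n \<in> T'" for n
  proof -
    have "x n \<in> T (Suc n)" by (simp add: x_def T_def)
    then show ?thesis by (auto simp: T'_def)
  qed
  have sub: "subspace (closure T')"
    unfolding T'_def T_def by (rule subspace_closure_span_stages)
  have Tmono: "T m \<subseteq> T n" if "m \<le> n" for m n
    unfolding T_def using that by (rule span_stage_mono)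
  have cluster_zero: "z = 0" if z: "\<And>m. z \<in> ?B closure_of {x n | n. m \<le> n}" for z
  proof -
    have in_closed: "blinfun_apply f z \<in> C"
      if "closed C" "\<And>n. m \<le> n \<Longrightarrow> blinfun_apply f (x n) \<in> C" for f :: "'a \<Rightarrow>\<^sub>L real" and C m
    proof -
      have "closedin ?B {y \<in> topspace ?B. blinfun_apply f y \<in> C}"
        using that(1) by (intro closedin_continuous_map_preimage[OF continuous_map_ball_functional]) simp
      moreover have "{x n | n. m \<le> n} \<subseteq> {y \<in> topspace ?B. blinfun_apply f y \<in> C}"
        using that(2) xB by auto
      ultimately have "?B closure_of {x n | n. m \<le> n} \<subseteq> {y \<in> topspace ?B. blinfun_apply f y \<in> C}"
        by (intro closure_of_minimal)
      then show ?thesis using z[of m] by blast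
    qed
    have J0: "blinfun_apply (J t) z = 0" if t: "t \<in> T'" for t
    proof -
      obtain k where k: "t \<in> T k" using t by (auto simp: T'_def)
      have "\<bar>blinfun_apply (J t) z\<bar> \<le> inverse (Suc m)" if m: "k \<le> m" for m
      proof -
        have "blinfun_apply (J t) z \<in> {- inverse (Suc m)..inverse (Suc m)}"
        proof (rule in_closed[where m = m])
          fix n assume n: "m \<le> n"
          then have "t \<in> T n" using Tmono[of k n] k m by auto
          then have "\<bar>blinfun_apply (J t) (x n)\<bar> < inverse (Suc n)" by (rule xJ)
          also have "\<dots> \<le> inverse (Suc m)" using n by (intro le_imp_inverse_le) auto
          finally show "blinfun_apply (J t) (x n) \<in> {- inverse (Suc m)..inverse (Suc m)}"
            by (simp add: abs_if split: if_splits)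
        qed simp
        then show ?thesis by auto
      qed
      then have "\<bar>blinfun_apply (J t) z\<bar> \<le> 0"
        by (intro LIMSEQ_le_const[OF LIMSEQ_inverse_real_of_nat]) auto
      then show ?thesis by simp
    qed
    have "z \<in> closure T'"
    proof (rule ccontr)
      assume "z \<notin> closure T'"
      then obtain f :: "'a \<Rightarrow>\<^sub>L real" where f: "\<And>s. s \<in> closure T' \<Longrightarrow> blinfun_apply f s = 0" "blinfun_apply f z \<noteq> 0"
        using functional_vanishing_on_closed_subspace[OF sub closed_closure] by blast
      have "blinfun_apply f z \<in> {0}"
        using xT closure_subset by (intro in_closed[where m = 0]) (auto intro!: f(1))
      with f(2) show False by simp
    qed
    have "norm z \<le> 0"
    proof (rule field_le_epsilon)
      fix e :: real assume "0 < e"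
      then obtain t where t: "t \<in> T'" "dist t z < e / 2"
        using \<open>z \<in> closure T'\<close> by (meson closure_approachable half_gt_zero)
      have "norm t = blinfun_apply (J t) (t - z)" using J0[OF t(1)] J(2) by (simp add: blinfun.diff_right)
      also have "\<dots> \<le> norm (J t) * norm (t - z)" using norm_blinfun[of "J t" "t - z"] by simp
      also have "\<dots> \<le> norm (t - z)" using J(1)[of t] by (simp add: mult_left_le_one_le)
      finally have "norm t \<le> norm (t - z)" .
      moreover have "norm z \<le> norm t + norm (t - z)" by (metis norm_triangle_sub norm_minus_commute)
      ultimately show "norm z \<le> 0 + e" using t(2) by (simp add: dist_norm)
    qed
    then show ?thesis by simp
  qed
  have "limitin ?B x 0 sequentially"
    unfolding limitin_sequentially
  proof (intro conjI allI impI)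
    fix V assume V: "openin ?B V \<and> 0 \<in> V"
    show "\<exists>N. \<forall>n\<ge>N. x n \<in> V"
    proof (rule ccontr)
      assume *: "\<not> ?thesis"
      define C where "C m = {x n | n. m \<le> n \<and> x n \<notin> V}" for m
      have "\<exists>z\<in>topspace ?B. \<forall>m. z \<in> ?B closure_of C m"
      proof (rule cl)
        show "C m \<noteq> {}" for m using * by (auto simp: C_def)
        show "decseq C" by (auto simp: decseq_def C_def)
        show "\<exists>U\<in>\<U> m. C m \<subseteq> U" for m
          using U0(1)[of m] xU[of m] by (auto simp: C_def intro!: bexI[of _ "U0 m"])
      qed
      then obtain z where z: "\<And>m. z \<in> ?B closure_of C m" by blast
      have "C m \<subseteq> {x n | n. m \<le> n}" for m by (auto simp: C_def)
      then have "z = 0" using z closure_of_mono by (intro cluster_zero) blast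
      moreover have "closedin ?B (topspace ?B - V)" using V by blast
      then have "?B closure_of C 0 \<subseteq> topspace ?B - V"
        using xB by (intro closure_of_minimal) (auto simp: C_def)
      ultimately show False using z[of 0] V by blast
    qed
  qed simp
  with xA xB show ?thesis by (rule that)
qed

text \<open>The base consists of interiors of finite unions of members of the network. If no finite union of the
members \<open>d 0, d 1, ...\<close> contained in \<open>U\<close> were a neighbourhood of \<open>0\<close>, then \<open>0\<close> would lie in the
closure of each complement of \<open>d 0 \<union> ... \<union> d n\<close>. A sequence selected from these complements converges
to \<open>0\<close> but meets every \<open>d k\<close> only finitely often, against the network property.\<close>

lemma weak_ball_countable_base_at_zero:
  assumes cs: "countable_cs_star_character (weak_unit_ball :: 'a::real_normed_vector topology)"
    and cech: "cech_complete_space (weak_unit_ball :: 'a topology)"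
  obtains \<B> where "countable \<B>" "\<And>V. V \<in> \<B> \<Longrightarrow> openin (weak_unit_ball :: 'a topology) V \<and> 0 \<in> V"
    "\<And>U. openin (weak_unit_ball :: 'a topology) U \<Longrightarrow> 0 \<in> U \<Longrightarrow> \<exists>V\<in>\<B>. V \<subseteq> U"
proof -
  let ?B = "weak_unit_ball :: 'a topology"
  have "0 \<in> topspace ?B" by simp
  then obtain \<D> where D: "countable \<D>" and net: "cs_star_network_at ?B 0 \<D>"
    using cs unfolding countable_cs_star_character_alt by blast
  define \<B> where "\<B> = {V. 0 \<in> V \<and> V \<in> (\<lambda>\<F>. ?B interior_of \<Union>\<F>) ` {\<F>. finite \<F> \<and> \<F> \<subseteq> \<D>}}"
  have "\<exists>V\<in>\<B>. V \<subseteq> U" if U: "openin ?B U" "0 \<in> U" for U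
  proof (rule ccontr)
    assume none: "\<not> ?thesis"
    \<comment> \<open>The empty set is added only so that the enumeration is total.\<close>
    define \<D>\<^sub>U where "\<D>\<^sub>U = insert {} {D \<in> \<D>. D \<subseteq> U}"
    have cnt: "countable \<D>\<^sub>U" using D by (simp add: \<D>\<^sub>U_def)
    define d where "d = from_nat_into \<D>\<^sub>U"
    have d: "d i \<in> \<D>\<^sub>U" for i unfolding d_def by (rule from_nat_into) (simp add: \<D>\<^sub>U_def)
    define A where "A n = topspace ?B - (\<Union>i\<le>n. d i)" for n
    have "0 \<in> ?B closure_of A n" for n
    proof -
      define \<F> where "\<F> = d ` {..n} - {{}}"
      have F: "finite \<F>" "\<F> \<subseteq> \<D>" "\<Union>\<F> = (\<Union>i\<le>n. d i)" "\<Union>\<F> \<subseteq> U"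
        using d by (auto simp: \<F>_def \<D>\<^sub>U_def)
      have "?B interior_of \<Union>\<F> \<subseteq> U" using interior_of_subset F(4) by (rule order_trans)
      with none F(1,2) have "0 \<notin> ?B interior_of \<Union>\<F>" by (auto simp: \<B>_def)
      then show ?thesis by (simp add: A_def closure_of_complement F(3) del: topspace_weak_unit_ball) simp
    qed
    then obtain x where x: "\<And>n. x n \<in> A n" "\<And>n. x n \<in> cball 0 1" "limitin ?B x 0 sequentially"
      using weak_ball_sequence_selection[OF cech] by blast
    have "range x \<subseteq> topspace ?B" using x(2) by auto
    then obtain D where D: "D \<in> \<D>" "D \<subseteq> U" "infinite {n. x n \<in> D}"
      using cs_star_network_atD[OF net _ x(3) U] by blast
    then have "D \<in> \<D>\<^sub>U" by (simp add: \<D>\<^sub>U_def)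
    then obtain k where k: "D = d k" unfolding d_def using cnt by (metis from_nat_into_surj)
    have "{n. x n \<in> D} \<subseteq> {..<k}"
    proof
      fix n assume "n \<in> {n. x n \<in> D}"
      then have "x n \<in> d k" by (simp add: k)
      then have "\<not> k \<le> n" using x(1)[of n] by (auto simp: A_def)
      then show "n \<in> {..<k}" by simp
    qed
    then show False using D(3) finite_subset by blast
  qed
  moreover have "countable \<B>"
    unfolding \<B>_def
    by (rule countable_subset[OF _ countable_image[OF countable_Collect_finite_subset[OF D]]]) blast
  moreover have "openin ?B V \<and> 0 \<in> V" if "V \<in> \<B>" for V
    using that by (auto simp: \<B>_def)
  ultimately show ?thesis by (intro that) auto
qed

section \<open>Polishness of the unit ball\<close>

text \<open>The functionals \<open>g k\<close> give every point of the ball a neighbourhood base, so the topology of the ball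
is the one induced by the evaluations \<open>x \<mapsto> (g k x)\<close>.\<close>

definition generates_weak_ball :: "(nat \<Rightarrow> 'a::real_normed_vector \<Rightarrow>\<^sub>L real) \<Rightarrow> bool" where
  "generates_weak_ball g \<longleftrightarrow> (\<forall>U x. openin weak_unit_ball U \<longrightarrow> x \<in> U \<longrightarrow>
     (\<exists>N e. 0 < e \<and> {y \<in> cball 0 1. \<forall>k\<le>N. \<bar>blinfun_apply (g k) (y - x)\<bar> < e} \<subseteq> U))"

text \<open>Each member of a countable base at \<open>0\<close> involves finitely many functionals. They also control all
other points \<open>x\<close> of the ball, because \<open>(y - x) / 2\<close> stays in the ball for \<open>y\<close> in the ball.\<close>

lemma weak_ball_countably_many_functionals:
  assumes cs: "countable_cs_star_character (weak_unit_ball :: 'a::real_normed_vector topology)"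
    and cech: "cech_complete_space (weak_unit_ball :: 'a topology)"
  shows "\<exists>g :: nat \<Rightarrow> 'a \<Rightarrow>\<^sub>L real. generates_weak_ball g"
proof -
  let ?B = "weak_unit_ball :: 'a topology"
  obtain \<B> where \<B>: "countable \<B>" "\<And>V. V \<in> \<B> \<Longrightarrow> openin ?B V \<and> 0 \<in> V"
    and base: "\<And>U. openin ?B U \<Longrightarrow> 0 \<in> U \<Longrightarrow> \<exists>V\<in>\<B>. V \<subseteq> U"
    using weak_ball_countable_base_at_zero[OF cs cech] by metis
  define good where "good V F e \<longleftrightarrow> finite F \<and> 0 < e \<and>
    {y \<in> cball 0 1. \<forall>f\<in>F. \<bar>blinfun_apply f y\<bar> < e} \<subseteq> V" for V and F :: "('a \<Rightarrow>\<^sub>L real) set" and e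
  have "\<exists>F e. good V F e" if V: "V \<in> \<B>" for V
  proof -
    obtain W where W: "openin weak_topology W" "V = W \<inter> cball 0 1"
      using \<B>(2)[OF V] by (auto simp: weak_unit_ball_def openin_subtopology)
    have "0 \<in> W" using \<B>(2)[OF V] W(2) by simp
    then obtain F :: "('a \<Rightarrow>\<^sub>L real) set" and e where "finite F" "0 < e"
      "{y. \<forall>f\<in>F. \<bar>blinfun_apply f (y - 0)\<bar> < e} \<subseteq> W"
      by (rule weak_neighbourhood_functionals[OF W(1)])
    then have "good V F e" by (auto simp: good_def W(2))
    then show ?thesis by blast
  qed
  then obtain F e where good: "\<And>V. V \<in> \<B> \<Longrightarrow> good V (F V) (e V)" by metis
  define G where "G = insert 0 (\<Union>V\<in>\<B>. F V)"
  have "countable (F V)" if "V \<in> \<B>" for V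
    using good[OF that] by (auto simp: good_def intro: countable_finite)
  then have G: "countable G" "G \<noteq> {}" using \<B>(1) by (auto simp: G_def)
  have "generates_weak_ball (from_nat_into G)"
    unfolding generates_weak_ball_def
  proof (intro allI impI)
    fix U :: "'a set" and x assume U: "openin ?B U" and x: "x \<in> U"
    have xB: "norm x \<le> 1" using openin_subset[OF U] x by auto
    obtain W where W: "openin weak_topology W" "U = W \<inter> cball 0 1"
      using U by (auto simp: weak_unit_ball_def openin_subtopology)
    have "openin weak_topology {z. x + 2 *\<^sub>R z \<in> W}"
      using openin_continuous_map_preimage[OF continuous_map_weak_affine[of x 2] W(1)] by simp
    then have "openin ?B ({z. x + 2 *\<^sub>R z \<in> W} \<inter> cball 0 1)"
      by (auto simp: weak_unit_ball_def openin_subtopology)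
    moreover have "0 \<in> {z. x + 2 *\<^sub>R z \<in> W} \<inter> cball 0 1" using x W(2) by simp
    ultimately obtain V where V: "V \<in> \<B>" "V \<subseteq> {z. x + 2 *\<^sub>R z \<in> W} \<inter> cball 0 1" by (meson base)
    have FV: "finite (F V)" "0 < e V" "{y \<in> cball 0 1. \<forall>f\<in>F V. \<bar>blinfun_apply f y\<bar> < e V} \<subseteq> V"
      using good[OF V(1)] by (auto simp: good_def)
    have "\<exists>N. F V \<subseteq> from_nat_into G ` {..N}"
    proof -
      have "F V \<subseteq> range (from_nat_into G)"
        unfolding range_from_nat_into[OF G(2,1)] using V(1) by (auto simp: G_def)
      then obtain K where K: "finite K" "F V = from_nat_into G ` K"
        using finite_subset_image[OF FV(1)] by metis
      then have "K \<subseteq> {..Max (insert 0 K)}" by auto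
      then show ?thesis using K(2) by blast
    qed
    then obtain N where N: "F V \<subseteq> from_nat_into G ` {..N}" by blast
    have "{y \<in> cball 0 1. \<forall>k\<le>N. \<bar>blinfun_apply (from_nat_into G k) (y - x)\<bar> < e V} \<subseteq> U"
    proof
      fix y assume y: "y \<in> {y \<in> cball 0 1. \<forall>k\<le>N. \<bar>blinfun_apply (from_nat_into G k) (y - x)\<bar> < e V}"
      \<comment> \<open>Halving the difference brings it back into the ball, where the base at \<open>0\<close> applies.\<close>
      define z where "z = (1/2) *\<^sub>R (y - x)"
      have "\<bar>blinfun_apply f z\<bar> < e V" if "f \<in> F V" for f
      proof -
        have "\<bar>blinfun_apply f (y - x)\<bar> < e V" using that N y by auto
        then show ?thesis using FV(2) by (simp add: z_def blinfun.scaleR_right)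
      qed
      moreover have "norm z \<le> 1"
        using y xB norm_triangle_ineq4[of y x] by (simp add: z_def)
      ultimately have "z \<in> V" using FV(3) by auto
      then have "x + 2 *\<^sub>R z \<in> W" using V(2) by auto
      then show "y \<in> U" using y W(2) by (simp add: z_def)
    qed
    then show "\<exists>N e. 0 < e \<and> {y \<in> cball 0 1. \<forall>k\<le>N. \<bar>blinfun_apply (from_nat_into G k) (y - x)\<bar> < e} \<subseteq> U"
      using FV(2) by blast
  qed
  then show ?thesis by blast
qed

lemma weak_ball_embeds_in_sequences:
  fixes g :: "nat \<Rightarrow> 'a::real_normed_vector \<Rightarrow>\<^sub>L real"
  assumes g: "generates_weak_ball g"
    and Haus: "Hausdorff_space (weak_unit_ball :: 'a topology)"
  shows "embedding_map (weak_unit_ball :: 'a topology) (euclidean :: (nat \<Rightarrow> real) topology)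
           (\<lambda>x k. blinfun_apply (g k) x)"
proof -
  let ?B = "weak_unit_ball :: 'a topology"
  define \<phi> where "\<phi> x k = blinfun_apply (g k) x" for x k
  have cont: "continuous_map ?B euclidean \<phi>"
    unfolding euclidean_product_topology[symmetric] continuous_map_componentwise_UNIV
    by (simp add: \<phi>_def continuous_map_ball_functional)
  have inj: "inj_on \<phi> (topspace ?B)"
  proof (rule inj_onI, rule ccontr)
    fix x y assume xy: "x \<in> topspace ?B" "y \<in> topspace ?B" "\<phi> x = \<phi> y" "x \<noteq> y"
    obtain U V where "openin ?B U" "x \<in> U" "openin ?B V" "y \<in> V" "disjnt U V"
      using Haus xy unfolding Hausdorff_space_def by meson
    then obtain N e where "0 < e" "{y \<in> cball 0 1. \<forall>k\<le>N. \<bar>blinfun_apply (g k) (y - x)\<bar> < e} \<subseteq> U"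
      using g unfolding generates_weak_ball_def by blast
    moreover have "blinfun_apply (g k) (y - x) = 0" for k
      using fun_cong[OF xy(3), of k] by (simp add: \<phi>_def blinfun.diff_right)
    ultimately have "y \<in> U" using xy(2) by auto
    with \<open>y \<in> V\<close> \<open>disjnt U V\<close> show False by (auto simp: disjnt_def)
  qed
  define P where "P = \<phi> ` topspace ?B"
  have "openin (top_of_set P) (\<phi> ` U)" if U: "openin ?B U" for U
  proof (subst openin_subopen, intro ballI)
    fix w assume "w \<in> \<phi> ` U"
    then obtain x where x: "x \<in> U" "w = \<phi> x" by blast
    obtain N e where e: "0 < e" "{y \<in> cball 0 1. \<forall>k\<le>N. \<bar>blinfun_apply (g k) (y - x)\<bar> < e} \<subseteq> U"
      using g U x(1) unfolding generates_weak_ball_def by blast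
    define W where "W = (\<Inter>k\<in>{..N}. {v. \<bar>v k - w k\<bar> < e})"
    have "open W"
      unfolding W_def
      by (intro open_INT ballI finite_atMost open_Collect_less continuous_intros continuous_on_product_coordinates)
    then have "openin (top_of_set P) (P \<inter> W)" by (rule openin_open_Int)
    moreover have "w \<in> P \<inter> W"
      using openin_subset[OF U] x e(1) by (auto simp: W_def P_def)
    moreover have "P \<inter> W \<subseteq> \<phi> ` U"
    proof
      fix v assume "v \<in> P \<inter> W"
      then obtain y where y: "y \<in> cball 0 1" "v = \<phi> y" and "v \<in> W" by (auto simp: P_def)
      have "\<bar>blinfun_apply (g k) (y - x)\<bar> < e" if "k \<le> N" for k
        using that \<open>v \<in> W\<close> y(2) x(2) by (auto simp: W_def \<phi>_def blinfun.diff_right)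
      with y(1) have "y \<in> U" using e(2) by auto
      then show "v \<in> \<phi> ` U" using y(2) by blast
    qed
    ultimately show "\<exists>T. openin (top_of_set P) T \<and> w \<in> T \<and> T \<subseteq> \<phi> ` U" by blast
  qed
  then have "open_map ?B (top_of_set P) \<phi>" by (simp add: open_map_def)
  moreover have "continuous_map ?B (top_of_set P) \<phi>"
    using cont by (auto simp: continuous_map_in_subtopology P_def)
  ultimately have "embedding_map ?B (top_of_set P) \<phi>"
    using inj by (intro injective_open_imp_embedding_map)
  then show ?thesis
    by (simp add: embedding_map_in_subtopology \<phi>_def[abs_def])
qed

lemma second_countable_euclidean:
  "second_countable (euclidean :: 'a::second_countable_topology topology)"
proof -
  obtain B :: "'a set set" where "countable B" "topological_basis B"
    using ex_countable_basis by blast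
  then show ?thesis
    unfolding second_countable_def
    by (intro exI[of _ B]) (auto simp: topological_basis_open elim!: topological_basisE)
qed

lemma polish_weak_ball:
  assumes cs: "countable_cs_star_character (weak_unit_ball :: 'a::real_normed_vector topology)"
    and cech: "cech_complete_space (weak_unit_ball :: 'a topology)"
  shows "polish_space_top (weak_unit_ball :: 'a topology)"
proof -
  let ?B = "weak_unit_ball :: 'a topology"
  obtain g :: "nat \<Rightarrow> 'a \<Rightarrow>\<^sub>L real" where g: "generates_weak_ball g"
    using weak_ball_countably_many_functionals[OF cs cech] by blast
  define \<phi> where "\<phi> = (\<lambda>x k. blinfun_apply (g k) x)"
  define P where "P = \<phi> ` topspace ?B"
  have Haus: "Hausdorff_space ?B" using cech by (simp add: cech_complete_space_def)
  have "embedding_map ?B euclidean \<phi>"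
    unfolding \<phi>_def using Haus by (intro weak_ball_embeds_in_sequences g)
  then have hom: "homeomorphic_map ?B (top_of_set P) \<phi>"
    by (simp add: embedding_map_def P_def)
  then have homs: "?B homeomorphic_space top_of_set P" by (rule homeomorphic_map_imp_homeomorphic_space)
  have "gdelta_in euclidean P" by (rule cech_complete_subset_imp_gdelta[OF hom cech])
  then have "completely_metrizable_space (top_of_set P)"
    using completely_metrizable_space_gdelta_in[OF completely_metrizable_space_euclidean] by blast
  then have "completely_metrizable_space ?B"
    using homeomorphic_completely_metrizable_space[OF homs] by simp
  moreover have "separable_space (top_of_set P)"
    by (intro second_countable_imp_separable_space second_countable_subtopology second_countable_euclidean)
  then have "separable_space ?B"
    using homeomorphic_separable_space[OF homs] by simp
  ultimately show ?thesis by (simp add: polish_space_top_def)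
qed

section \<open>The equivalence\<close>

theorem corollary1p10:
  fixes Ew Bw :: "'e::banach topology"
  defines "Ew \<equiv> weak_topology"
    and "Bw \<equiv> weak_unit_ball"
  shows "(polish_space_top Bw
            \<longleftrightarrow> cech_complete_space Bw \<and> aleph_space Bw)
       \<and> (cech_complete_space Bw \<and> aleph_space Bw
            \<longleftrightarrow> countable_cs_star_character Bw \<and> cech_complete_space Bw)
       \<and> (countable_cs_star_character Bw \<and> cech_complete_space Bw
            \<longleftrightarrow> countable_cs_star_character Ew \<and> cech_complete_space Bw)"
proof -
  have "cech_complete_space Bw \<and> aleph_space Bw" if "polish_space_top Bw"
    using that polish_imp_aleph_space completely_metrizable_imp_cech_complete_space
    by (auto simp: polish_space_top_def)
  moreover have "countable_cs_star_character Bw" if "aleph_space Bw"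
    using that by (rule aleph_space_imp_countable_cs_star_character)
  moreover have "polish_space_top Bw" if "countable_cs_star_character Bw" "cech_complete_space Bw"
    using that unfolding Bw_def by (rule polish_weak_ball)
  moreover have "countable_cs_star_character Ew" if "countable_cs_star_character Bw"
    using that unfolding Bw_def Ew_def by (rule countable_cs_star_character_weak_from_ball)
  moreover have "countable_cs_star_character Bw" if "countable_cs_star_character Ew"
    using that unfolding Bw_def Ew_def weak_unit_ball_def by (rule countable_cs_star_character_subtopology)
  ultimately show ?thesis by blast
qed

end
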